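(* Let $\theta\in\mathbb{R}$ and let $(G,o)$ be a unimodular random rooted graph with maximum degree at most $D$. If $G$ is $\theta$-critical with probability $1$, then $G$ is finite with probability $1$.
   Context: Matching measure: for a graph $G$ of maximum degree at most $D$ and vertex $u$, $\nu_{G,u}$ is the spectral measure at the one-vertex path $u$ of the adjacency operator of the path tree $T(G,u)$ (vertices: finite paths in $G$ starting at $u$; two paths adjacent iff one is obtained from the other by deleting its last vertex). A vertex $u$ is $\theta$-essential if $\nu_{G,u}(\{\theta\})>0$; $G$ is $\theta$-critical if all its vertices are $\theta$-essential. A random rooted (connected) graph $(G,o)$ is unimodular if for every non-negative measurable $f$ on bi-rooted graphs, $\mathbb{E}\sum_{v} f(G,o,v)=\mathbb{E}\sum_{v}f(G,v,o)$. *)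

theory Defs
  imports "HOL-Probability.Probability"
begin

text \<open>A (possibly infinite) graph is an edge predicate E on nat.  A rooted graph
(E, o) is the connected component of o in E.\<close>

definition component :: "(nat \<Rightarrow> nat \<Rightarrow> bool) \<Rightarrow> nat \<Rightarrow> nat set" where
  "component E r = {v. E\<^sup>*\<^sup>* r v}"

definition simple_graph :: "(nat \<Rightarrow> nat \<Rightarrow> bool) \<Rightarrow> bool" where
  "simple_graph E \<longleftrightarrow> (\<forall>x y. E x y \<longrightarrow> E y x) \<and> (\<forall>x. \<not> E x x)"

definition max_deg_le :: "(nat \<Rightarrow> nat \<Rightarrow> bool) \<Rightarrow> nat \<Rightarrow> nat \<Rightarrow> bool" where
  "max_deg_le E r D \<longleftrightarrow> (\<forall>v\<in>component E r. finite {w. E v w} \<and> card {w. E v w} \<le> D)"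

definition is_path :: "(nat \<Rightarrow> nat \<Rightarrow> bool) \<Rightarrow> nat \<Rightarrow> nat list \<Rightarrow> bool" where
  "is_path E u p \<longleftrightarrow> p \<noteq> [] \<and> hd p = u \<and> distinct p \<and>
     (\<forall>i. Suc i < length p \<longrightarrow> E (p ! i) (p ! Suc i))"

definition tree_adj :: "nat list \<Rightarrow> nat list \<Rightarrow> bool" where
  "tree_adj p q \<longleftrightarrow> (\<exists>w. q = p @ [w]) \<or> (\<exists>w. p = q @ [w])"

text \<open>Closed walks of length k at the root [u] of T(G,u); their number is
  the k-th moment  <A^k e_root, e_root>  of the adjacency operator A of T(G,u).\<close>
definition closed_walks :: "(nat \<Rightarrow> nat \<Rightarrow> bool) \<Rightarrow> nat \<Rightarrow> nat \<Rightarrow> nat list list set" where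
  "closed_walks E u k = {ws. length ws = Suc k \<and> ws ! 0 = [u] \<and> ws ! k = [u] \<and>
      (\<forall>i\<le>k. is_path E u (ws ! i)) \<and> (\<forall>i<k. tree_adj (ws ! i) (ws ! Suc i))}"

text \<open>The spectral measure of the (bounded, self-adjoint) adjacency operator of T(G,u) at
  the root vector: the Borel probability measure on the reals whose moments are
  <A^k e_root, e_root>.  For bounded degree this measure exists and is unique.\<close>
definition matching_measure :: "(nat \<Rightarrow> nat \<Rightarrow> bool) \<Rightarrow> nat \<Rightarrow> real measure" where
  "matching_measure E u = (THE \<mu>. prob_space \<mu> \<and> sets \<mu> = sets borel \<and>
      (\<forall>k. integrable \<mu> (\<lambda>x. x ^ k) \<and>
           (\<integral>x. x ^ k \<partial>\<mu>) = real (card (closed_walks E u k))))"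

definition essential :: "real \<Rightarrow> (nat \<Rightarrow> nat \<Rightarrow> bool) \<Rightarrow> nat \<Rightarrow> bool" where
  "essential \<theta> E u \<longleftrightarrow> measure (matching_measure E u) {\<theta>} > 0"

definition critical :: "real \<Rightarrow> (nat \<Rightarrow> nat \<Rightarrow> bool) \<Rightarrow> nat \<Rightarrow> bool" where
  "critical \<theta> E r \<longleftrightarrow> (\<forall>u\<in>component E r. essential \<theta> E u)"

definition graph_space :: "(nat \<Rightarrow> nat \<Rightarrow> bool) measure" where
  "graph_space = PiM UNIV (\<lambda>_. PiM UNIV (\<lambda>_. count_space UNIV))"

definition birooted_invariant :: "((nat \<Rightarrow> nat \<Rightarrow> bool) \<Rightarrow> nat \<Rightarrow> nat \<Rightarrow> ennreal) \<Rightarrow> bool" where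
  "birooted_invariant f \<longleftrightarrow> (\<forall>E r v E' r' h.
      v \<in> component E r \<and> bij_betw h (component E r) (component E' r') \<and> h r = r' \<and>
      (\<forall>x\<in>component E r. \<forall>y\<in>component E r. E x y \<longleftrightarrow> E' (h x) (h y))
      \<longrightarrow> f E' r' (h v) = f E r v)"

definition unimodular :: "'a measure \<Rightarrow> ('a \<Rightarrow> nat \<Rightarrow> nat \<Rightarrow> bool) \<Rightarrow> ('a \<Rightarrow> nat) \<Rightarrow> bool" where
  "unimodular M G rt \<longleftrightarrow>
    (\<forall>f. (\<lambda>(E, x, y). f E x y) \<in> borel_measurable (graph_space \<Otimes>\<^sub>M count_space UNIV \<Otimes>\<^sub>M count_space UNIV)
       \<and> birooted_invariant f \<longrightarrow>
       (\<integral>\<^sup>+ \<omega>. (\<Sum>v. if v \<in> component (G \<omega>) (rt \<omega>) then f (G \<omega>) (rt \<omega>) v else 0) \<partial>M) =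
       (\<integral>\<^sup>+ \<omega>. (\<Sum>v. if v \<in> component (G \<omega>) (rt \<omega>) then f (G \<omega>) v (rt \<omega>) else 0) \<partial>M))"

end

theory Submission
  imports Defs "HOL-Computational_Algebra.Fundamental_Theorem_Algebra"
begin

text \<open>Let \<open>p\<^sub>V(u)\<close> be the mass at \<open>\<theta>\<close> of the matching measure of \<open>u\<close> in the subgraph induced on \<open>V\<close>. For a finite
  vertex set the Stieltjes transform of the matching measure is the ratio of matching polynomials
  \<open>\<mu>(S - u) / \<mu>(S)\<close>, because the products of these ratios along paths solve the resolvent equation on the
  path tree. Godsil's identities for \<open>\<mu>\<close>, evaluated at \<open>\<theta> + \<i>\<epsilon>\<close>, give inequalities between finitely many such ratios
  which survive the passage to infinite graphs and then \<open>\<epsilon> \<rightarrow> 0\<close>. They show, as in Gallai's lemma, that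
  in a connected \<open>\<theta>\<close>-critical graph deleting any vertex \<open>u\<close> makes every other vertex inessential, and then that
  \<open>\<Sum>\<^sub>v p\<^sub>V(v) \<le> 1\<close>. If every \<open>v\<close> receives mass \<open>p\<^sub>V(v)\<close> from each vertex of its component, then the root sends
  at most \<open>1\<close> but receives \<open>|V| p\<^sub>V(o)\<close>, so unimodularity forces \<open>V\<close> to be finite almost surely.\<close>

section \<open>Matching polynomials of finite graphs\<close>

text \<open>For finite \<open>S\<close> the mass of \<open>u\<close> at \<open>\<theta>\<close> is
  the residue there of \<open>\<mu>(S - u) / \<mu>(S)\<close>. These residues add up to the
  multiplicity of \<open>\<theta>\<close> as a root of \<open>\<mu>(S)\<close>, because the
  derivative of \<open>\<mu>(S)\<close> is \<open>\<Sum>\<^sub>u \<mu>(S - u)\<close>. The bound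
  \<open>1\<close> on the total mass thus stands for the fact that a connected critical graph has
  \<open>\<theta>\<close> as a simple root. Infinite graphs have no multiplicities, so each
  comparison of multiplicities becomes an inequality between ratios whose constants do not depend on
  the size of the graph. Godsil's identities are sums over paths, whose number is unbounded; they
  are controlled by the Ward identity, by which the squared moduli of the resolvent entries between
  the root and all paths add up to \<open>- Im G / Im z\<close>. A factor
  \<open>\<i> * \<epsilon>\<close> at each ratio produces quantities that tend to atoms, and the
  powers of \<open>\<epsilon>\<close> left over decide what vanishes. The three-vertex comparison
  mixes paths in \<open>S\<close> with paths in \<open>S - {c}\<close>; it is bounded with a free
  weight \<open>t\<close>, which tends to \<open>0\<close> only after
  \<open>\<epsilon>\<close>.\<close>

text \<open>Expanding at the least vertex is an arbitrary choice, see \<open>matching_poly_expand\<close>.\<close>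

function matching_poly :: "(nat \<Rightarrow> nat \<Rightarrow> bool) \<Rightarrow> complex \<Rightarrow> nat set \<Rightarrow> complex" where
  "matching_poly E z S = (if finite S \<and> S \<noteq> {} then
     z * matching_poly E z (S - {Min S}) -
     (\<Sum>v\<in>{v \<in> S - {Min S}. E (Min S) v}. matching_poly E z (S - {Min S} - {v})) else 1)"
  by auto
termination
  apply (relation "Wellfounded.measure (\<lambda>(E, z, S). card S)")
    apply (auto simp: card_gt_0_iff)
  done

declare matching_poly.simps [simp del]

lemma Diff_swap: "A - {x} - {y} = A - {y} - {x}" by auto

text \<open>The weight \<open>t\<close> stays free, since it is the parameter that later tends to
  \<open>0\<close> in the transitivity argument for atoms. The optimal factor \<open>1/4\<close> at
  \<open>y\<^sup>2 / t\<close> is given up for a lighter formula.\<close>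

lemma amgm_weighted:
  fixes x y t :: real
  assumes "t > 0"
  shows "x * y \<le> t * x\<^sup>2 + y\<^sup>2 / t"
proof -
  have "0 \<le> (t * x - y / 2)\<^sup>2" by simp
  then have "t * (x * y) \<le> t * (t * x\<^sup>2) + y\<^sup>2 / 4" by (simp add: power2_eq_square algebra_simps)
  also have "\<dots> \<le> t * (t * x\<^sup>2) + y\<^sup>2" by simp
  finally have "t * (x * y) / t \<le> (t * (t * x\<^sup>2) + y\<^sup>2) / t" using assms by (intro divide_right_mono) auto
  then show ?thesis using assms by (simp add: field_simps)
qed

context
  fixes E :: "nat \<Rightarrow> nat \<Rightarrow> bool" and z :: complex
  assumes sym: "symp E"
begin

private abbreviation "mp \<equiv> matching_poly E z"
private abbreviation "nbs S u \<equiv> {v \<in> S - {u}. E u v}"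

lemma sum_nbs_insert:
  assumes "finite T" "s \<notin> T" "u \<notin> T" "s \<noteq> u"
  shows "(\<Sum>v\<in>{v \<in> insert s T. E u v}. f v) = (if E u s then f s else 0) + (\<Sum>v\<in>{v \<in> T. E u v}. (f v :: complex))"
proof -
  have "{v \<in> insert s T. E u v} = (if E u s then insert s {v \<in> T. E u v} else {v \<in> T. E u v})" by auto
  then show ?thesis using assms by simp
qed

text \<open>Expanding at \<open>u\<close> and at \<open>s = Min S\<close>, in either order, produces
  the same terms: no edge, the edge between \<open>u\<close> and \<open>s\<close>, one edge at
  \<open>u\<close> or at \<open>s\<close> only, two disjoint edges. The induction hypothesis
  supplies the second expansion, on smaller sets.\<close>

lemma matching_poly_expand:
  assumes "finite S" "u \<in> S"
  shows "mp S = z * mp (S - {u}) - (\<Sum>v\<in>nbs S u. mp (S - {u} - {v}))"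
  using assms
proof (induction S arbitrary: u rule: finite_psubset_induct)
  case (psubset S)
  define s where "s = Min S"
  have sS: "s \<in> S" using psubset.hyps psubset.prems Min_in[of S] unfolding s_def by blast
  have exp_s: "mp S = z * mp (S - {s}) - (\<Sum>v\<in>nbs S s. mp (S - {s} - {v}))"
    using psubset.hyps psubset.prems unfolding s_def by (subst matching_poly.simps) auto
  show ?case
  proof (cases "u = s")
    case True
    then show ?thesis using exp_s by simp
  next
    case False
    define T where "T = S - {s} - {u}"
    have fT: "finite T" using psubset T_def by auto
    have Ts: "S - {s} = insert u T" "S - {u} = insert s T" "u \<notin> T" "s \<notin> T"
      using T_def sS psubset.prems False by auto
    have e: "mp (insert a T - X) = z * mp (T - X) - (\<Sum>v\<in>{v \<in> T - X. E a v}. mp (T - X - {v}))"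
      if "a \<in> {u, s}" "X \<subseteq> T" for a X
    proof -
      have ps: "insert a T - X \<subset> S" using that Ts False sS psubset.prems by auto
      have aT: "a \<notin> T" using that Ts by auto
      then have *: "insert a T - X - {a} = T - X" using that by auto
      have "a \<in> insert a T - X" using aT that by auto
      from psubset.IH[OF ps this] show ?thesis unfolding * .
    qed
    \<comment> \<open>The result of expanding \<open>S\<close> at \<open>b\<close> and then at
      \<open>a\<close>. Up to the order in the double sum and the test \<open>E b a\<close> it is
      symmetric in \<open>a\<close> and \<open>b\<close>.\<close>
    have half: "z * mp (insert a T) - (\<Sum>v\<in>{v \<in> insert a T. E b v}. mp (insert a T - {v}))
        = z * z * mp T - z * (\<Sum>v\<in>{v \<in> T. E a v}. mp (T - {v})) - z * (\<Sum>v\<in>{v \<in> T. E b v}. mp (T - {v}))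
          - (if E b a then mp T else 0)
          + (\<Sum>v\<in>{v \<in> T. E b v}. \<Sum>x\<in>{x \<in> {x \<in> T. E a x}. v \<noteq> x}. mp (T - {v} - {x}))"
      if ab: "a \<in> {u, s}" "b \<in> {u, s}" "a \<noteq> b" for a b
    proof -
      have "a \<notin> T" "b \<notin> T" using ab Ts by auto
      have "(\<Sum>v\<in>{v \<in> insert a T. E b v}. mp (insert a T - {v}))
         = (if E b a then mp T else 0) + (\<Sum>v\<in>{v \<in> T. E b v}. mp (insert a T - {v}))"
        using sum_nbs_insert[of T a b "\<lambda>v. mp (insert a T - {v})"] \<open>a \<notin> T\<close> \<open>b \<notin> T\<close> ab fT by simp
      also have "(\<Sum>v\<in>{v \<in> T. E b v}. mp (insert a T - {v}))
        = (\<Sum>v\<in>{v \<in> T. E b v}. z * mp (T - {v}) - (\<Sum>x\<in>{x \<in> {x \<in> T. E a x}. v \<noteq> x}. mp (T - {v} - {x})))"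
      proof (rule sum.cong[OF refl], goal_cases)
        case (1 v)
        have "{x \<in> T - {v}. E a x} = {x \<in> {x \<in> T. E a x}. v \<noteq> x}" by auto
        then show ?case using e[OF ab(1), of "{v}"] 1 by auto
      qed
      finally have 1: "(\<Sum>v\<in>{v \<in> insert a T. E b v}. mp (insert a T - {v})) = (if E b a then mp T else 0)
          + (z * (\<Sum>v\<in>{v \<in> T. E b v}. mp (T - {v}))
          - (\<Sum>v\<in>{v \<in> T. E b v}. \<Sum>x\<in>{x \<in> {x \<in> T. E a x}. v \<noteq> x}. mp (T - {v} - {x})))"
        by (simp only: sum_subtractf sum_distrib_left)
      have 2: "mp (insert a T) = z * mp T - (\<Sum>v\<in>{v \<in> T. E a v}. mp (T - {v}))"
        using e[OF ab(1), of "{}"] by simp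
      have "z * (z * m - A) - (X + (z * B - C)) = z * z * m - z * A - z * B - X + C" for m A B C X
        by (simp add: algebra_simps)
      then show ?thesis unfolding 1 2 .
    qed
    have sw: "(\<Sum>v\<in>{v \<in> T. E s v}. \<Sum>x\<in>{x \<in> {x \<in> T. E u x}. v \<noteq> x}. mp (T - {v} - {x}))
      = (\<Sum>v\<in>{v \<in> T. E u v}. \<Sum>x\<in>{x \<in> {x \<in> T. E s x}. v \<noteq> x}. mp (T - {v} - {x}))"
    proof -
      have "(\<Sum>v\<in>{v \<in> T. E s v}. \<Sum>x\<in>{x \<in> {x \<in> T. E u x}. v \<noteq> x}. mp (T - {v} - {x}))
         = (\<Sum>x\<in>{x \<in> T. E u x}. \<Sum>v\<in>{v \<in> {v \<in> T. E s v}. v \<noteq> x}. mp (T - {v} - {x}))"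
        using sum.swap_restrict[of "{v \<in> T. E s v}" "{x \<in> T. E u x}" "\<lambda>v x. mp (T - {v} - {x})" "(\<noteq>)"] fT
        by simp
      also have "\<dots> = (\<Sum>v\<in>{v \<in> T. E u v}. \<Sum>x\<in>{x \<in> {x \<in> T. E s x}. v \<noteq> x}. mp (T - {v} - {x}))"
        by (intro sum.cong) (auto intro!: arg_cong[of _ _ mp])
      finally show ?thesis .
    qed
    have "(if E u s then mp T else 0) = (if E s u then mp T else 0)" using sympD[OF sym] by auto
    then show ?thesis using exp_s half[of u s] half[of s u] sw False unfolding Ts by simp
  qed
qed

lemma matching_poly_empty [simp]: "mp {} = 1"
  by (subst matching_poly.simps) simp

context
  assumes z: "Im z > 0"
begin

text \<open>Divided by \<open>mp (S - {u})\<close>, the expansion is \<open>z\<close> minus ratios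
  with nonpositive imaginary part by induction. So \<open>mp S / mp (S - {u})\<close> stays in the
  open upper half-plane and its inverse in the lower one (the Heilmann-Lieb argument).\<close>

lemma matching_poly_nz_Im_neg:
  assumes "finite S"
  shows "mp S \<noteq> 0 \<and> (\<forall>u\<in>S. Im (mp (S - {u}) / mp S) < 0)"
  using assms
proof (induction S rule: finite_psubset_induct)
  case (psubset S)
  have *: "mp S \<noteq> 0 \<and> Im (mp (S - {u}) / mp S) < 0" if u: "u \<in> S" for u
  proof -
    have ps: "S - {u} \<subset> S" using u by auto
    have nz: "mp (S - {u}) \<noteq> 0" using psubset.IH[OF ps] by blast
    have "mp S / mp (S - {u}) = z - (\<Sum>v\<in>nbs S u. mp (S - {u} - {v}) / mp (S - {u}))"
      using matching_poly_expand[OF psubset.hyps u] nz by (simp add: diff_divide_distrib sum_divide_distrib)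
    moreover have "(\<Sum>v\<in>nbs S u. Im (mp (S - {u} - {v}) / mp (S - {u}))) \<le> 0"
      using psubset.IH[OF ps] by (intro sum_nonpos) (auto intro: less_imp_le)
    ultimately have pos: "Im (mp S / mp (S - {u})) > 0" using z by simp
    then have "mp S \<noteq> 0" by auto
    moreover have "Im (inverse (mp S / mp (S - {u}))) < 0"
      using pos unfolding inverse_complex.sel by (intro divide_neg_pos) (auto simp: sum_power2_gt_zero_iff)
    ultimately show ?thesis by (simp add: divide_inverse mult.commute)
  qed
  show ?case
  proof (cases "S = {}")
    case False
    then show ?thesis using * by blast
  qed simp
qed

lemma matching_poly_nonzero: "finite S \<Longrightarrow> mp S \<noteq> 0"
  using matching_poly_nz_Im_neg by blast

text \<open>The sum of \<open>|mp (S - P)|\<^sup>2\<close> over all paths \<open>P\<close> in \<open>S\<close> starting at \<open>u\<close>, in closed form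
  (Ward identity); see \<open>path_weight_rec\<close>.\<close>

definition path_weight :: "nat set \<Rightarrow> nat \<Rightarrow> real" where
  "path_weight S u = (if u \<in> S then - Im (mp (S - {u}) * cnj (mp S)) / Im z else 0)"

text \<open>A path from \<open>u\<close> is \<open>u\<close> alone, or \<open>u\<close> followed by
  a path in \<open>S - {u}\<close> from a neighbour. In the formula, expanding
  \<open>cnj (mp S)\<close> gives the square with factor \<open>Im z\<close>, and each remaining
  term has the shape of a path weight in \<open>S - {u}\<close>.\<close>

lemma path_weight_rec:
  assumes "finite S" "u \<in> S"
  shows "path_weight S u = (cmod (mp (S - {u})))\<^sup>2 + (\<Sum>x\<in>nbs S u. path_weight (S - {u}) x)"
proof -
  let ?a = "mp (S - {u})"
  have "mp (S - {u}) * cnj (mp S) = cnj z * (?a * cnj ?a) - (\<Sum>v\<in>nbs S u. ?a * cnj (mp (S - {u} - {v})))"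
    by (subst matching_poly_expand[OF assms]) (simp add: algebra_simps sum_distrib_left)
  also have "?a * cnj ?a = of_real ((cmod ?a)\<^sup>2)" by (rule complex_norm_square[symmetric])
  finally have "- Im (mp (S - {u}) * cnj (mp S)) =
    Im z * (cmod ?a)\<^sup>2 + (\<Sum>v\<in>nbs S u. Im (?a * cnj (mp (S - {u} - {v}))))" by simp
  also have "(\<Sum>v\<in>nbs S u. Im (?a * cnj (mp (S - {u} - {v})))) = (\<Sum>v\<in>nbs S u. Im z * path_weight (S - {u}) v)"
    using z by (intro sum.cong refl) (auto simp: path_weight_def field_simps)
  finally show ?thesis using z assms
    by (simp add: path_weight_def field_simps sum_distrib_left)
qed

lemma path_weight_nonneg:
  assumes "finite S"
  shows "path_weight S u \<ge> 0"
  using assms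
proof (induction S arbitrary: u rule: finite_psubset_induct)
  case (psubset S)
  show ?case
  proof (cases "u \<in> S")
    case True
    then have "path_weight (S - {u}) x \<ge> 0" for x by (intro psubset.IH) auto
    then show ?thesis using psubset path_weight_rec[of S u] True by (auto intro!: add_nonneg_nonneg sum_nonneg)
  qed (simp add: path_weight_def)
qed

lemma path_weight_ge: "finite S \<Longrightarrow> u \<in> S \<Longrightarrow> (cmod (mp (S - {u})))\<^sup>2 \<le> path_weight S u"
  using path_weight_rec[of S u] by (auto intro!: sum_nonneg path_weight_nonneg)

text \<open>By Godsil's identity this is the sum of \<open>(mp (S - P))\<^sup>2\<close> over all paths \<open>P\<close> in \<open>S\<close> from \<open>u\<close> to \<open>v\<close>.\<close>

definition wronskian :: "nat set \<Rightarrow> nat \<Rightarrow> nat \<Rightarrow> complex" where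
  "wronskian S u v = (if u = v then (mp (S - {u}))\<^sup>2
     else mp (S - {u}) * mp (S - {v}) - mp S * mp (S - {u} - {v}))"

text \<open>The factors that still contain \<open>u\<close>, namely \<open>mp S\<close> and
  \<open>mp (S - {v})\<close>, are expanded at \<open>u\<close>, and the terms with \<open>z\<close>
  cancel. The neighbour \<open>x = v\<close> occurs only in the expansion of \<open>mp S\<close>; it
  yields the square that ends a path.\<close>

lemma wronskian_rec:
  assumes S: "finite S" "u \<in> S" "v \<in> S" "u \<noteq> v"
  shows "wronskian S u v = (\<Sum>x\<in>nbs S u. wronskian (S - {u}) x v)"
proof -
  let ?T = "S - {u}"
  have nb: "nbs (S - {v}) u = nbs S u - {v}" by auto
  have fin: "finite (nbs S u)" using S by auto
  have "wronskian S u v = mp ?T * mp (S - {v}) - mp S * mp (?T - {v})"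
    using S by (simp add: wronskian_def)
  also have "mp (S - {v}) = z * mp (?T - {v}) - (\<Sum>x\<in>nbs S u - {v}. mp (?T - {v} - {x}))"
    using matching_poly_expand[of "S - {v}" u] S unfolding nb by (simp add: Diff_swap[of S v u])
  also have "mp S = z * mp ?T - (\<Sum>x\<in>nbs S u. mp (?T - {x}))"
    using matching_poly_expand[of S u] S by simp
  finally have 1: "wronskian S u v = (\<Sum>x\<in>nbs S u. mp (?T - {x})) * mp (?T - {v})
      - (\<Sum>x\<in>nbs S u - {v}. mp (?T - {v} - {x})) * mp ?T"
    by (simp add: algebra_simps)
  also have "\<dots> = (\<Sum>x\<in>nbs S u. mp (?T - {x}) * mp (?T - {v})
     - (if x = v then 0 else mp ?T * mp (?T - {v} - {x})))"
  proof -
    have "(\<Sum>x\<in>nbs S u - {v}. mp (?T - {v} - {x})) * mp ?T = (\<Sum>x\<in>nbs S u - {v}. mp ?T * mp (?T - {v} - {x}))"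
      by (simp add: sum_distrib_left mult.commute)
    also have "\<dots> = (\<Sum>x\<in>nbs S u. (if x = v then 0 else mp ?T * mp (?T - {v} - {x})))"
      by (rule sum.mono_neutral_cong_left) (use fin in auto)
    finally show ?thesis by (simp add: sum_subtractf sum_distrib_right)
  qed
  also have "\<dots> = (\<Sum>x\<in>nbs S u. wronskian ?T x v)"
    by (intro sum.cong refl) (auto simp: wronskian_def power2_eq_square Diff_swap[of "?T" v])
  finally show ?thesis .
qed

text \<open>Different \<open>v\<close> collect different paths from \<open>u\<close>, so the
  triangle inequality bounds the left side by the sum of squared moduli over all paths. The
  induction follows the first step of the path.\<close>

lemma sum_wronskian_le:
  assumes "finite S" "u \<in> S" "F \<subseteq> S"
  shows "(\<Sum>v\<in>F. cmod (wronskian S u v)) \<le> path_weight S u"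
  using assms
proof (induction S arbitrary: u F rule: finite_psubset_induct)
  case (psubset S)
  have finF: "finite F" using psubset finite_subset by blast
  have "(\<Sum>v\<in>F. cmod (wronskian S u v)) \<le> cmod (wronskian S u u) + (\<Sum>v\<in>F - {u}. cmod (wronskian S u v))"
    using finF by (cases "u \<in> F") (simp_all add: sum.remove)
  also have "(\<Sum>v\<in>F - {u}. cmod (wronskian S u v)) \<le> (\<Sum>v\<in>F - {u}. \<Sum>x\<in>nbs S u. cmod (wronskian (S - {u}) x v))"
  proof (rule sum_mono)
    fix v assume v: "v \<in> F - {u}"
    then have "wronskian S u v = (\<Sum>x\<in>nbs S u. wronskian (S - {u}) x v)"
      using psubset by (intro wronskian_rec) auto
    then show "cmod (wronskian S u v) \<le> (\<Sum>x\<in>nbs S u. cmod (wronskian (S - {u}) x v))"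
      using norm_sum by metis
  qed
  also have "\<dots> = (\<Sum>x\<in>nbs S u. \<Sum>v\<in>F - {u}. cmod (wronskian (S - {u}) x v))" by (rule sum.swap)
  also have "\<dots> \<le> (\<Sum>x\<in>nbs S u. path_weight (S - {u}) x)"
    using psubset by (intro sum_mono psubset.IH) auto
  also have "cmod (wronskian S u u) + \<dots> = path_weight S u"
    using path_weight_rec[OF psubset.hyps psubset.prems(1)] by (simp add: wronskian_def norm_power)
  finally show ?case by simp
qed

text \<open>The polarised analogue: for distinct \<open>a\<close>, \<open>b\<close>, \<open>c\<close> it is the sum of \<open>mp (S - P) * mp (S - {c} - P)\<close> over the
  paths \<open>P\<close> from \<open>b\<close> to \<open>a\<close> avoiding \<open>c\<close>, plus the same expression with \<open>a\<close> and \<open>c\<close> exchanged.\<close>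

definition wronskian3 :: "nat set \<Rightarrow> nat \<Rightarrow> nat \<Rightarrow> nat \<Rightarrow> complex" where
  "wronskian3 S b a c = (if b = a \<or> b = c then mp (S - {b}) * mp (S - {a} - {c})
     else mp (S - {b}) * mp (S - {a} - {c}) - mp S * mp (S - {a} - {c} - {b}))"

lemma wronskian3_rec:
  assumes S: "finite S" "a \<in> S" "b \<in> S" "c \<in> S" "b \<noteq> a" "b \<noteq> c" "a \<noteq> c"
  shows "wronskian3 S b a c = (\<Sum>x\<in>nbs S b. wronskian3 (S - {b}) x a c)"
proof -
  let ?T = "S - {b}"
  have sw: "S - {a} - {c} - {b} = ?T - {a} - {c}" by auto
  have nb: "{v \<in> ?T - {a} - {c}. E b v} = nbs S b - {a, c}" by auto
  have fin: "finite (nbs S b)" using S by auto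
  have "wronskian3 S b a c = mp ?T * mp (S - {a} - {c}) - mp S * mp (?T - {a} - {c})"
    using S by (simp add: wronskian3_def sw)
  also have "mp (S - {a} - {c}) = z * mp (?T - {a} - {c}) - (\<Sum>x\<in>nbs S b - {a, c}. mp (?T - {a} - {c} - {x}))"
    using matching_poly_expand[of "S - {a} - {c}" b] S unfolding sw nb by blast
  also have "mp S = z * mp ?T - (\<Sum>x\<in>nbs S b. mp (?T - {x}))"
    using matching_poly_expand[of S b] S by simp
  finally have 1: "wronskian3 S b a c = (\<Sum>x\<in>nbs S b. mp (?T - {x})) * mp (?T - {a} - {c})
      - (\<Sum>x\<in>nbs S b - {a, c}. mp (?T - {a} - {c} - {x})) * mp ?T"
    by (simp add: algebra_simps)
  also have "\<dots> = (\<Sum>x\<in>nbs S b. mp (?T - {x}) * mp (?T - {a} - {c})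
     - (if x = a \<or> x = c then 0 else mp ?T * mp (?T - {a} - {c} - {x})))"
  proof -
    have "(\<Sum>x\<in>nbs S b - {a, c}. mp (?T - {a} - {c} - {x})) * mp ?T
       = (\<Sum>x\<in>nbs S b - {a, c}. mp ?T * mp (?T - {a} - {c} - {x}))"
      by (simp add: sum_distrib_left mult.commute)
    also have "\<dots> = (\<Sum>x\<in>nbs S b. (if x = a \<or> x = c then 0 else mp ?T * mp (?T - {a} - {c} - {x})))"
      by (rule sum.mono_neutral_cong_left) (use fin in auto)
    finally show ?thesis by (simp add: sum_subtractf sum_distrib_right)
  qed
  also have "\<dots> = (\<Sum>x\<in>nbs S b. wronskian3 ?T x a c)"
    by (intro sum.cong refl) (auto simp: wronskian3_def)
  finally show ?thesis .
qed

text \<open>In the path expansion each product \<open>mp (S - P) * mp (S - {c} - P)\<close> is split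
  by \<open>amgm_weighted\<close>. Paths ending at \<open>a\<close> differ from paths ending at
  \<open>c\<close>, so the first squares share one \<open>path_weight S b\<close>; the second
  squares belong to paths in \<open>S - {c}\<close> or \<open>S - {a}\<close>.\<close>

lemma wronskian3_le:
  assumes "finite S" "a \<in> S" "b \<in> S" "c \<in> S" "a \<noteq> c" and t: "t > 0"
  shows "cmod (wronskian3 S b a c) \<le> t * path_weight S b + (path_weight (S - {a}) b + path_weight (S - {c}) b) / t"
  using assms
proof (induction S arbitrary: b rule: finite_psubset_induct)
  case (psubset S)
  note fin = psubset.hyps
  show ?case
  proof (cases "b = a \<or> b = c")
    case True
    \<comment> \<open>The one of \<open>a\<close> and \<open>c\<close> that the one-vertex path
      \<open>b\<close> avoids.\<close>
    define d where "d = (if b = a then c else a)"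
    have d: "d \<noteq> b" "d \<in> S" "S - {a} - {c} = S - {d} - {b}" and bS: "b \<in> S" "b \<in> S - {d}"
      using True psubset.prems by (auto simp: d_def)
    have "cmod (wronskian3 S b a c) = cmod (mp (S - {b})) * cmod (mp (S - {d} - {b}))"
      using True d by (auto simp: wronskian3_def norm_mult)
    also have "\<dots> \<le> t * (cmod (mp (S - {b})))\<^sup>2 + (cmod (mp (S - {d} - {b})))\<^sup>2 / t"
      by (rule amgm_weighted[OF t])
    also have "\<dots> \<le> t * path_weight S b + path_weight (S - {d}) b / t"
      using t fin bS by (intro add_mono mult_left_mono divide_right_mono path_weight_ge) auto
    also have "path_weight (S - {d}) b / t \<le> (path_weight (S - {a}) b + path_weight (S - {c}) b) / t"
      using t fin path_weight_nonneg[of "S - {a}" b] path_weight_nonneg[of "S - {c}" b]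
      by (intro divide_right_mono) (auto simp: d_def)
    finally show ?thesis by simp
  next
    case False
    let ?T = "S - {b}"
    have w: "(\<Sum>x\<in>nbs S b. path_weight ?T x) \<le> path_weight S b"
      using path_weight_rec[of S b] fin psubset.prems by simp
    \<comment> \<open>The neighbours of \<open>b\<close> in \<open>S\<close> and in
      \<open>S - {d}\<close> differ at most by \<open>d\<close>, where
      \<open>path_weight (?T - {d}) d\<close> is \<open>0\<close> by definition.\<close>
    have wd: "(\<Sum>x\<in>nbs S b. path_weight (?T - {d}) x) \<le> path_weight (S - {d}) b" if "d \<noteq> b" for d
    proof -
      have "(\<Sum>x\<in>nbs S b. path_weight (?T - {d}) x) = (\<Sum>x\<in>nbs (S - {d}) b. path_weight (S - {d} - {b}) x)"
        using fin by (intro sum.mono_neutral_cong_right) (auto simp: path_weight_def Diff_swap)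
      also have "\<dots> \<le> path_weight (S - {d}) b"
        using path_weight_rec[of "S - {d}" b] fin psubset.prems that by simp
      finally show ?thesis .
    qed
    have "cmod (wronskian3 S b a c) \<le> (\<Sum>x\<in>nbs S b. cmod (wronskian3 ?T x a c))"
      using wronskian3_rec[of S a b c] fin psubset.prems False by (simp add: norm_sum)
    also have "\<dots> \<le> (\<Sum>x\<in>nbs S b. t * path_weight ?T x + (path_weight (?T - {a}) x + path_weight (?T - {c}) x) / t)"
      using psubset.prems False by (intro sum_mono psubset.IH) auto
    also have "\<dots> = t * (\<Sum>x\<in>nbs S b. path_weight ?T x)
       + ((\<Sum>x\<in>nbs S b. path_weight (?T - {a}) x) + (\<Sum>x\<in>nbs S b. path_weight (?T - {c}) x)) / t"
      by (simp add: sum.distrib sum_distrib_left sum_divide_distrib add_divide_distrib)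
    also have "\<dots> \<le> t * path_weight S b + (path_weight (S - {a}) b + path_weight (S - {c}) b) / t"
      using t w wd[of a] wd[of c] False by (intro add_mono mult_left_mono divide_right_mono) auto
    finally show ?thesis .
  qed
qed

section \<open>Inequalities between ratios of matching polynomials\<close>

definition mratio :: "nat set \<Rightarrow> nat \<Rightarrow> complex" where
  "mratio S u = mp (S - {u}) / mp S"

lemma path_weight_mratio:
  assumes "finite S" "u \<in> S"
  shows "path_weight S u = (cmod (mp S))\<^sup>2 * (- Im (mratio S u) / Im z)"
proof -
  have "mp (S - {u}) * cnj (mp S) = mratio S u * of_real ((cmod (mp S))\<^sup>2)"
    using matching_poly_nonzero[OF assms(1)] by (simp add: mratio_def complex_norm_square del: of_real_power)
  then show ?thesis using assms by (simp add: path_weight_def)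
qed

lemma mratio_sym:
  assumes "finite S"
  shows "mratio S a * mratio (S - {a}) b = mratio S b * mratio (S - {b}) a"
  using assms by (simp add: mratio_def matching_poly_nonzero Diff_swap[of S a b])

text \<open>Only the paths with second vertex \<open>v\<close> are kept in the Ward sum.\<close>

lemma mratio_adjacent:
  assumes "finite S" "u \<in> S" "v \<in> S" "u \<noteq> v" "E u v"
  shows "(cmod (mratio S u))\<^sup>2 * (- Im (mratio (S - {u}) v)) \<le> - Im (mratio S u)"
proof -
  have "path_weight (S - {u}) v \<le> (\<Sum>x\<in>nbs S u. path_weight (S - {u}) x)"
    using assms by (intro member_le_sum) (auto intro: path_weight_nonneg)
  also have "\<dots> \<le> path_weight S u" using path_weight_rec[of S u] assms by simp
  finally have "(cmod (mp (S - {u})))\<^sup>2 * (- Im (mratio (S - {u}) v)) \<le> (cmod (mp S))\<^sup>2 * (- Im (mratio S u))"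
    using assms z by (simp add: path_weight_mratio divide_le_cancel)
  then have "(cmod (mp (S - {u})))\<^sup>2 * (- Im (mratio (S - {u}) v)) / (cmod (mp S))\<^sup>2 \<le> - Im (mratio S u)"
    using matching_poly_nonzero[OF assms(1)] by (subst pos_divide_le_eq) (simp, simp only: mult.commute[of _ "(cmod (mp S))\<^sup>2"])
  then show ?thesis by (simp add: mratio_def norm_divide power_divide)
qed

text \<open>This is \<open>sum_wronskian_le\<close> divided by the squared modulus of
  \<open>mp S\<close>, with the term \<open>v = u\<close> split off. The differences measure how the
  ratio at \<open>v\<close> reacts to the deletion of \<open>u\<close>.\<close>

lemma sum_mratio_le:
  assumes "finite S" "u \<in> S" "F \<subseteq> S - {u}"
  shows "(cmod (mratio S u))\<^sup>2 + (\<Sum>v\<in>F. cmod (mratio S u * (mratio S v - mratio (S - {u}) v))) \<le> - Im (mratio S u) / Im z"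
proof -
  let ?m = "(cmod (mp S))\<^sup>2"
  have nz: "?m > 0" using matching_poly_nonzero[OF assms(1)] by simp
  have w: "cmod (wronskian S u v) = ?m * cmod (mratio S u * (mratio S v - mratio (S - {u}) v))" if "v \<in> F" for v
  proof -
    have "u \<noteq> v" using that assms by auto
    then have "wronskian S u v = (mp S)\<^sup>2 * (mratio S u * (mratio S v - mratio (S - {u}) v))"
      using matching_poly_nonzero[OF assms(1)] matching_poly_nonzero[of "S - {u}"] assms(1)
      by (simp add: wronskian_def mratio_def field_simps power2_eq_square)
    then show ?thesis by (simp add: norm_mult norm_power)
  qed
  have "cmod (wronskian S u u) = ?m * (cmod (mratio S u))\<^sup>2"
    using nz by (simp add: wronskian_def mratio_def norm_divide norm_power power_divide)
  moreover have "(\<Sum>v\<in>insert u F. cmod (wronskian S u v)) \<le> path_weight S u"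
    using assms by (intro sum_wronskian_le) auto
  moreover have "finite F" "u \<notin> F" using assms finite_subset by blast+
  ultimately have "?m * ((cmod (mratio S u))\<^sup>2 + (\<Sum>v\<in>F. cmod (mratio S u * (mratio S v - mratio (S - {u}) v))))
      \<le> ?m * (- Im (mratio S u) / Im z)"
    using w path_weight_mratio[OF assms(1,2)] by (simp add: distrib_left sum_distrib_left)
  then show ?thesis using nz by (simp only: mult_le_cancel_left_pos)
qed

text \<open>This is \<open>wronskian3_le\<close> divided by the squared modulus of
  \<open>mp S\<close>. Writing the products as ratios along successive deletions gives every factor
  a limit of its own in an infinite graph.\<close>

lemma mratio_three_le:
  assumes "finite S" "a \<in> S" "b \<in> S" "c \<in> S" "a \<noteq> c" "a \<noteq> b" "b \<noteq> c" and t: "t > 0"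
  shows "cmod (mratio S b * mratio S a * mratio (S - {a}) c - mratio S b * mratio (S - {b}) a * mratio (S - {a} - {b}) c)
    \<le> t * (- Im (mratio S b) / Im z)
      + ((cmod (mratio S a))\<^sup>2 * (- Im (mratio (S - {a}) b) / Im z)
       + (cmod (mratio S c))\<^sup>2 * (- Im (mratio (S - {c}) b) / Im z)) / t"
proof -
  let ?m = "(cmod (mp S))\<^sup>2"
  note nz = matching_poly_nonzero
  have m0: "?m > 0" using matching_poly_nonzero[OF assms(1)] by simp
  have fin: "finite (S - X)" for X using assms by auto
  have eq: "S - {a} - {c} - {b} = S - {a} - {b} - {c}" "S - {b} - {a} = S - {a} - {b}" by auto
  have "wronskian3 S b a c = (mp S)\<^sup>2 *
    (mratio S b * mratio S a * mratio (S - {a}) c - mratio S b * mratio (S - {b}) a * mratio (S - {a} - {b}) c)"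
  proof -
    have n: "mp S \<noteq> 0" "mp (S - {a}) \<noteq> 0" "mp (S - {b}) \<noteq> 0" "mp (S - {a} - {b}) \<noteq> 0"
      using assms(1) by (auto intro!: nz)
    have "(mp S)\<^sup>2 * (mratio S b * mratio S a * mratio (S - {a}) c) = mp (S - {b}) * mp (S - {a} - {c})"
      using n by (simp add: mratio_def power2_eq_square)
    moreover have "(mp S)\<^sup>2 * (mratio S b * mratio (S - {b}) a * mratio (S - {a} - {b}) c) = mp S * mp (S - {a} - {c} - {b})"
      using n unfolding mratio_def eq by (simp add: power2_eq_square)
    ultimately show ?thesis using assms by (simp add: wronskian3_def right_diff_distrib)
  qed
  then have "cmod (wronskian3 S b a c) = ?m *
    cmod (mratio S b * mratio S a * mratio (S - {a}) c - mratio S b * mratio (S - {b}) a * mratio (S - {a} - {b}) c)"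
    by (simp add: norm_mult norm_power)
  moreover have "path_weight (S - {d}) b = ?m * ((cmod (mratio S d))\<^sup>2 * (- Im (mratio (S - {d}) b) / Im z))"
    if "d \<noteq> b" for d
    using path_weight_mratio[of "S - {d}" b] assms that m0 by (simp add: mratio_def[of S d] norm_divide power_divide)
  then have "path_weight (S - {a}) b = ?m * ((cmod (mratio S a))\<^sup>2 * (- Im (mratio (S - {a}) b) / Im z))"
    "path_weight (S - {c}) b = ?m * ((cmod (mratio S c))\<^sup>2 * (- Im (mratio (S - {c}) b) / Im z))"
    using assms by auto
  moreover have "path_weight S b = ?m * (- Im (mratio S b) / Im z)"
    using path_weight_mratio assms by simp
  moreover have "cmod (wronskian3 S b a c) \<le> t * path_weight S b + (path_weight (S - {a}) b + path_weight (S - {c}) b) / t"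
    using assms by (intro wronskian3_le) auto
  moreover have factor_out: "t * (m * x) + (m * y + m * w) / t = m * (t * x + (y + w) / t)" for m x y w :: real
    using t by (simp add: field_simps)
  ultimately have "?m * cmod (mratio S b * mratio S a * mratio (S - {a}) c - mratio S b * mratio (S - {b}) a * mratio (S - {a} - {b}) c)
   \<le> ?m * (t * (- Im (mratio S b) / Im z)
      + ((cmod (mratio S a))\<^sup>2 * (- Im (mratio (S - {a}) b) / Im z)
       + (cmod (mratio S c))\<^sup>2 * (- Im (mratio (S - {c}) b) / Im z)) / t)"
    by (simp only: factor_out)
  then show ?thesis using m0 by (simp only: mult_le_cancel_left_pos)
qed

end
end

section \<open>Spectral decomposition of finite symmetric operators\<close>

text \<open>Gaussian elimination: a pivot \<open>k\<close> clears the coordinate \<open>y\<close>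
  from the other functions, and the induction continues with \<open>J - {k}\<close>.\<close>

lemma exists_nontrivial_combination:
  fixes f :: "'j \<Rightarrow> 'i \<Rightarrow> real"
  assumes "finite I" "finite J" "card I < card J"
  shows "\<exists>c. (\<exists>j\<in>J. c j \<noteq> 0) \<and> (\<forall>x\<in>I. (\<Sum>j\<in>J. c j * f j x) = 0)"
  using assms
proof (induction I arbitrary: J f rule: finite_induct)
  case empty
  then have "J \<noteq> {}" by auto
  then show ?case by (intro exI[of _ "\<lambda>_. 1"]) auto
next
  case (insert y I)
  show ?case
  proof (cases "\<forall>j\<in>J. f j y = 0")
    case True
    then show ?thesis using insert.IH[of J f] insert.prems insert.hyps by auto
  next
    case False
    then obtain k where k: "k \<in> J" "f k y \<noteq> 0" by auto
    define h where "h j x = f j x - f j y / f k y * f k x" for j x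
    have "card I < card (J - {k})" using insert.prems insert.hyps k by simp
    from insert.IH[OF _ this, of h] insert.prems obtain c j0 where
      c: "j0 \<in> J - {k}" "c j0 \<noteq> 0" "\<And>x. x \<in> I \<Longrightarrow> (\<Sum>j\<in>J - {k}. c j * h j x) = 0" by auto
    define c' where "c' j = (if j = k then - (\<Sum>j\<in>J - {k}. c j * f j y / f k y) else c j)" for j
    have *: "(\<Sum>j\<in>J. c' j * f j x) = (\<Sum>j\<in>J - {k}. c j * h j x)" for x
    proof -
      have "(\<Sum>j\<in>J. c' j * f j x) = c' k * f k x + (\<Sum>j\<in>J - {k}. c' j * f j x)"
        using insert.prems k by (simp add: sum.remove)
      also have "(\<Sum>j\<in>J - {k}. c' j * f j x) = (\<Sum>j\<in>J - {k}. c j * f j x)"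
        by (intro sum.cong) (auto simp: c'_def)
      also have "c' k * f k x = - (\<Sum>j\<in>J - {k}. c j * f j y / f k y * f k x)"
        by (simp add: c'_def sum_distrib_right)
      finally show ?thesis by (simp add: h_def right_diff_distrib sum_subtractf mult.assoc)
    qed
    have "h j y = 0" for j using k by (simp add: h_def)
    then have "\<forall>x\<in>insert y I. (\<Sum>j\<in>J. c' j * f j x) = 0" using c(3) by (auto simp: *)
    moreover have "c' j0 \<noteq> 0" "j0 \<in> J" using c by (auto simp: c'_def)
    ultimately show ?thesis by blast
  qed
qed

lemma prod_linear_dvd:
  fixes p :: "real poly"
  assumes "finite \<Lambda>" "\<And>l. l \<in> \<Lambda> \<Longrightarrow> poly p l = 0"
  shows "(\<Prod>l\<in>\<Lambda>. [:-l, 1:]) dvd p"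
  using assms
proof (induction \<Lambda> arbitrary: p rule: finite_induct)
  case (insert a \<Lambda>)
  then obtain s where s: "p = [:-a, 1:] * s" by (metis insertI1 poly_eq_0_iff_dvd dvdE)
  have "poly s l = 0" if "l \<in> \<Lambda>" for l
  proof -
    have "poly p l = (l - a) * poly s l" unfolding s by (simp add: algebra_simps)
    then show ?thesis using insert.prems[of l] insert.hyps that by auto
  qed
  then have "(\<Prod>l\<in>\<Lambda>. [:-l, 1:]) dvd s" by (rule insert.IH)
  then show ?case unfolding prod.insert[OF insert.hyps] s by (rule mult_dvd_mono[OF dvd_refl])
qed simp

lemma poly_of_real_mult:
  fixes p q :: "real poly" and z :: complex
  shows "poly (map_poly of_real (p * q)) z = poly (map_poly of_real p) z * poly (map_poly of_real q) z"
proof -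
  have add: "poly (map_poly of_real (p + q)) z = poly (map_poly of_real p) z + poly (map_poly of_real q) z"
    for p q :: "real poly"
  proof (induction p q rule: poly_induct2)
    case (pCons a p b q)
    then show ?case by (simp add: map_poly_pCons algebra_simps)
  qed simp
  have sm: "poly (map_poly of_real (smult c q)) z = of_real c * poly (map_poly of_real q) z" for c and q :: "real poly"
    by (induction q) (auto simp: map_poly_pCons algebra_simps)
  show ?thesis
    by (induction p) (simp_all add: add sm map_poly_pCons algebra_simps)
qed

text \<open>A non-real root \<open>c = a + \<i> * b\<close> is also a root of
  \<open>(x - a)\<^sup>2 + b\<^sup>2\<close>. The remainder modulo this quadratic is real, of degree
  below two, and vanishes at \<open>c\<close>, so it is zero.\<close>

lemma real_poly_factor_cases:
  fixes q :: "real poly"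
  assumes "degree q > 0"
  obtains (real) a where "poly q a = 0" | (quad) a b s where "b \<noteq> 0" "q = [:a\<^sup>2 + b\<^sup>2, - 2 * a, 1:] * s"
proof -
  let ?Q = "map_poly complex_of_real q"
  have "degree ?Q > 0" using assms by (simp add: degree_map_poly)
  then have "\<not> constant (poly ?Q)" by (simp add: constant_degree)
  then obtain c where c: "poly ?Q c = 0" using fundamental_theorem_of_algebra by blast
  show thesis
  proof (cases "Im c = 0")
    case True
    then obtain a where a: "c = of_real a" by (metis complex_is_Real_iff Reals_cases)
    have "poly ?Q (of_real a) = of_real (poly q a)"
      by (induction q) (simp_all add: map_poly_pCons)
    then show thesis using c a real by simp
  next
    case False
    define a b where "a = Re c" and "b = Im c"
    let ?d = "[:a\<^sup>2 + b\<^sup>2, - 2 * a, 1:]"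
    define r where "r = q mod ?d"
    have q: "q = ?d * (q div ?d) + r" unfolding r_def by (rule mult_div_mod_eq[symmetric])
    have "degree r < 2" using degree_mod_less[of ?d q] by (auto simp: r_def)
    then have r: "r = [:coeff r 0, coeff r 1:]"
      by (intro poly_eqI) (auto simp: coeff_pCons coeff_eq_0 split: nat.splits)
    have d0: "poly (map_poly complex_of_real ?d) c = 0"
      by (auto simp: map_poly_pCons a_def b_def complex_eq_iff power2_eq_square algebra_simps)
    have add: "poly (map_poly of_real (p + q)) c = poly (map_poly of_real p) c + poly (map_poly of_real q) c"
      for p q :: "real poly"
    proof (induction p q rule: poly_induct2)
      case (pCons a p b q)
      then show ?case by (simp add: map_poly_pCons algebra_simps)
    qed simp
    have "poly (map_poly of_real r) c = 0"
      using c d0 by (subst (asm) q) (simp only: add poly_of_real_mult, simp)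
    then have "of_real (coeff r 0) + c * of_real (coeff r 1) = 0"
      by (subst (asm) r) (simp add: map_poly_pCons)
    then have "coeff r 1 = 0" "coeff r 0 = 0" using False by (auto simp: complex_eq_iff)
    then have "r = 0" using r by simp
    then have "q = ?d * (q div ?d)" using q by (metis add_0_right)
    moreover have "b \<noteq> 0" using False b_def by simp
    ultimately show thesis by (rule quad[rotated])
  qed
qed

section \<open>Polynomials of a finite symmetric operator applied to the root vector\<close>

locale finite_graph_operator =
  fixes I :: "'i set" and R :: "'i \<Rightarrow> 'i \<Rightarrow> bool" and rt :: 'i
  assumes finI: "finite I" and Rsym: "R x y \<Longrightarrow> R y x" and rtI: "rt \<in> I"
begin

definition adj :: "('i \<Rightarrow> real) \<Rightarrow> 'i \<Rightarrow> real" where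
  "adj f x = (if x \<in> I then \<Sum>y\<in>{y \<in> I. R x y}. f y else 0)"

definition e0 :: "'i \<Rightarrow> real" where "e0 x = (if x = rt then 1 else 0)"

text \<open>The vector \<open>p(A) e\<close> for the operator \<open>A\<close> and the root vector
  \<open>e\<close>. The spectral measure at the root only sees the span of these vectors.\<close>

definition pact :: "real poly \<Rightarrow> 'i \<Rightarrow> real" where
  "pact p x = (\<Sum>i\<le>degree p. coeff p i * (adj ^^ i) e0 x)"

definition ip :: "('i \<Rightarrow> real) \<Rightarrow> ('i \<Rightarrow> real) \<Rightarrow> real" where
  "ip f g = (\<Sum>x\<in>I. f x * g x)"

lemma adj_pow_outside: "x \<notin> I \<Longrightarrow> (adj ^^ i) e0 x = 0"
  using rtI by (cases i) (auto simp: adj_def e0_def)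

lemma pact_outside: "x \<notin> I \<Longrightarrow> pact p x = 0"
  by (simp add: pact_def adj_pow_outside)

lemma pact_bound: "degree p \<le> n \<Longrightarrow> pact p x = (\<Sum>i\<le>n. coeff p i * (adj ^^ i) e0 x)"
  unfolding pact_def by (rule sum.mono_neutral_left) (auto simp: coeff_eq_0)

lemma pact_add: "pact (p + q) x = pact p x + pact q x"
  using pact_bound[of p "max (degree p) (degree q)" x] pact_bound[of q "max (degree p) (degree q)" x]
    pact_bound[of "p + q" "max (degree p) (degree q)" x]
  by (simp add: degree_add_le_max algebra_simps sum.distrib)

lemma pact_smult: "pact (smult c p) x = c * pact p x"
  using pact_bound[of "smult c p" "degree p" x]
  by (simp add: degree_smult_le pact_def sum_distrib_left algebra_simps)

lemma pact_diff: "pact (p - q) x = pact p x - pact q x"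
  using pact_add[of p "smult (-1) q" x] pact_smult[of "-1" q x] by simp

lemma pact_0 [simp]: "pact 0 x = 0" by (simp add: pact_def)

lemma pact_1: "pact 1 = e0" by (rule ext) (simp add: pact_def)

lemma pact_sum: "pact (sum f A) x = (\<Sum>a\<in>A. pact (f a) x)"
  by (induction A rule: infinite_finite_induct) (simp_all add: pact_add)

lemma adj_sum: "adj (\<lambda>y. \<Sum>i\<in>A. c i * f i y) x = (\<Sum>i\<in>A. c i * adj (f i) x)"
  unfolding adj_def by (auto simp: sum_distrib_left intro: sum.swap)

lemma pact_pCons: "pact (pCons c p) x = c * e0 x + adj (pact p) x"
proof -
  have "pact (pCons c p) x = (\<Sum>i\<le>Suc (degree p). coeff (pCons c p) i * (adj ^^ i) e0 x)"
    by (rule pact_bound) (rule degree_pCons_le)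
  also have "\<dots> = c * e0 x + (\<Sum>i\<le>degree p. coeff p i * adj ((adj ^^ i) e0) x)"
    by (subst sum.atMost_Suc_shift) simp
  also have "(\<Sum>i\<le>degree p. coeff p i * adj ((adj ^^ i) e0) x) = adj (pact p) x"
    unfolding pact_def[abs_def] by (rule adj_sum[symmetric])
  finally show ?thesis .
qed

lemma pact_pCons0: "pact (pCons 0 p) = adj (pact p)"
  by (rule ext) (simp add: pact_pCons)

lemma pact_monom: "pact (monom 1 k) = (adj ^^ k) e0"
  by (induction k) (simp_all add: monom_Suc monom_0 pact_pCons0 pact_1 one_pCons[symmetric])

lemma ip_adj: "ip (adj f) g = ip f (adj g)"
proof -
  have "ip (adj f) g = (\<Sum>x\<in>I. \<Sum>y\<in>{y \<in> I. R x y}. f y * g x)"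
    unfolding ip_def adj_def by (intro sum.cong refl) (simp add: sum_distrib_right)
  also have "\<dots> = (\<Sum>y\<in>I. \<Sum>x\<in>{x \<in> I. R x y}. f y * g x)"
    by (rule sum.swap_restrict[OF finI finI])
  also have "\<dots> = ip f (adj g)"
    unfolding ip_def adj_def using Rsym by (intro sum.cong refl) (auto simp: sum_distrib_left intro!: sum.cong)
  finally show ?thesis .
qed

lemma ip_lin: "ip (\<lambda>x. c * f x + g x) h = c * ip f h + ip g h" "ip h (\<lambda>x. c * f x + g x) = c * ip h f + ip h g"
  by (simp_all add: ip_def sum.distrib sum_distrib_left algebra_simps)

lemma pact_mult_pCons: "pact (pCons c q * r) = (\<lambda>x. c * pact r x + adj (pact (q * r)) x)"
  by (rule ext) (simp add: pact_add pact_smult pact_pCons)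

text \<open>Every \<open>q(A)\<close> is self-adjoint, because \<open>A\<close> is and can be moved
  across the product one factor at a time.\<close>

lemma ip_pact_mult: "ip (pact (q * r)) (pact s) = ip (pact r) (pact (q * s))"
proof (induction q arbitrary: r s)
  case 0
  then show ?case by (simp add: ip_def)
next
  case (pCons c q)
  have "ip (adj (pact (q * r))) (pact s) = ip (pact (q * r)) (pact (pCons 0 s))"
    by (simp add: ip_adj pact_pCons0)
  also have "\<dots> = ip (pact r) (pact (q * pCons 0 s))" by (rule pCons.IH)
  also have "\<dots> = ip (pact r) (adj (pact (q * s)))" by (simp add: pact_pCons0)
  finally have "ip (adj (pact (q * r))) (pact s) = ip (pact r) (adj (pact (q * s)))" .
  then show ?case unfolding pact_mult_pCons ip_lin by simp
qed

lemma ip_root: "ip f e0 = f rt"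
proof -
  have "ip f e0 = (\<Sum>x\<in>I. if x = rt then f x else 0)"
    unfolding ip_def e0_def by (intro sum.cong) auto
  then show ?thesis using finI rtI by (simp add: sum.delta)
qed

lemma ip_self_zero: "ip (pact p) (pact p) = 0 \<Longrightarrow> pact p = (\<lambda>_. 0)"
proof (rule ext)
  fix x assume "ip (pact p) (pact p) = 0"
  then have "\<forall>x\<in>I. pact p x * pact p x = 0"
    unfolding ip_def using finI by (subst (asm) sum_nonneg_eq_0_iff) auto
  then show "pact p x = 0" by (cases "x \<in> I") (auto simp: pact_outside)
qed

lemma ip_self_nonneg: "ip f f \<ge> 0"
  unfolding ip_def by (intro sum_nonneg) auto

text \<open>Moving one factor \<open>q\<close> across turns the squared norm of
  \<open>pact (q * p)\<close> into a product with \<open>pact p = 0\<close>.\<close>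

lemma pact_ideal: "pact p = (\<lambda>_. 0) \<Longrightarrow> pact (q * p) = (\<lambda>_. 0)"
proof -
  assume p: "pact p = (\<lambda>_. 0)"
  have "ip (pact (q * p)) (pact (q * p)) = ip (pact p) (pact (q * (q * p)))" by (rule ip_pact_mult)
  also have "\<dots> = 0" by (simp add: p ip_def)
  finally show ?thesis by (rule ip_self_zero)
qed

text \<open>The vectors \<open>(adj ^^ j) e0\<close> with \<open>j \<le> card I\<close> outnumber
  the coordinates by one, hence they are dependent.\<close>

lemma exists_annihilator: "\<exists>p. p \<noteq> 0 \<and> pact p = (\<lambda>_. 0)"
proof -
  from exists_nontrivial_combination[OF finI, of "{..card I}" "\<lambda>j. (adj ^^ j) e0"]
  obtain c j where c: "j \<le> card I" "c j \<noteq> 0" "\<And>x. x \<in> I \<Longrightarrow> (\<Sum>j\<le>card I. c j * (adj ^^ j) e0 x) = 0"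
    by auto
  define p where "p = (\<Sum>i\<le>card I. monom (c i) i)"
  have cp: "coeff p i = (if i \<le> card I then c i else 0)" for i
    by (simp add: p_def coeff_sum)
  have "degree p \<le> card I" by (rule degree_le) (simp add: cp)
  then have "pact p x = 0" for x
    using c(3)[of x] by (cases "x \<in> I") (simp add: pact_bound cp, simp add: pact_outside)
  moreover have "p \<noteq> 0" using c cp[of j] by auto
  ultimately show ?thesis by blast
qed

text \<open>By symmetry of the operator, the minimal polynomial of the root vector has simple real roots.\<close>

lemma exists_split_annihilator:
  "\<exists>\<Lambda>. finite \<Lambda> \<and> pact (\<Prod>l\<in>\<Lambda>. [:-l, 1:]) = (\<lambda>_. 0)"
proof -
  obtain p where p: "p \<noteq> 0" "pact p = (\<lambda>_. 0)"
    and pmin: "\<And>q. q \<noteq> 0 \<Longrightarrow> pact q = (\<lambda>_. 0) \<Longrightarrow> degree p \<le> degree q"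
    using exists_annihilator ex_has_least_nat[of "\<lambda>p. p \<noteq> 0 \<and> pact p = (\<lambda>_. 0)" _ degree] by blast
  \<comment> \<open>The squared norm of \<open>pact ((X - a) * s)\<close> equals the product of
    \<open>pact s\<close> with \<open>pact p = 0\<close>, so \<open>(X - a) * s\<close> is an
    annihilator of smaller degree.\<close>
  have no_square: False if "p = [:-a, 1:] * ([:-a, 1:] * s)" for a s
  proof -
    have "ip (pact ([:-a, 1:] * s)) (pact ([:-a, 1:] * s)) = ip (pact s) (pact p)"
      unfolding that by (rule ip_pact_mult)
    also have "\<dots> = 0" using p by (simp add: ip_def)
    finally have "pact ([:-a, 1:] * s) = (\<lambda>_. 0)" by (rule ip_self_zero)
    moreover have s0: "s \<noteq> 0" using p(1) that by auto
    then have t0: "[:-a, 1:] * s \<noteq> 0" by (simp del: mult_pCons_left)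
    ultimately have "degree p \<le> degree ([:-a, 1:] * s)" by (intro pmin)
    moreover have "degree p = 1 + degree ([:-a, 1:] * s)"
      unfolding that using t0 by (subst degree_mult_eq) (simp_all del: mult_pCons_left)
    ultimately show False by simp
  qed
  \<comment> \<open>The product of \<open>pact s\<close> with \<open>pact p = 0\<close> is the
    squared norm of \<open>pact ((X - a) * s)\<close> plus \<open>b\<^sup>2\<close> times that of
    \<open>pact s\<close>. Both vanish, and \<open>s\<close> contradicts minimality.\<close>
  have no_quad: False if "b \<noteq> 0" "p = [:a\<^sup>2 + b\<^sup>2, - 2 * a, 1:] * s" for a b s
  proof -
    have split: "p = [:-a, 1:] * ([:-a, 1:] * s) + smult (b\<^sup>2) s"
      unfolding that(2) by (intro poly_eqI) (simp add: coeff_pCons algebra_simps power2_eq_square split: nat.splits)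
    have "0 = ip (pact s) (pact p)" using p by (simp add: ip_def)
    also have "pact p = (\<lambda>x. b\<^sup>2 * pact s x + pact ([:-a, 1:] * ([:-a, 1:] * s)) x)"
      by (rule ext) (subst split, simp only: pact_add pact_smult add.commute)
    also have "ip (pact s) \<dots> = b\<^sup>2 * ip (pact s) (pact s) + ip (pact s) (pact ([:-a, 1:] * ([:-a, 1:] * s)))"
      by (rule ip_lin)
    also have "ip (pact s) (pact ([:-a, 1:] * ([:-a, 1:] * s))) = ip (pact ([:-a, 1:] * s)) (pact ([:-a, 1:] * s))"
      by (rule ip_pact_mult[symmetric])
    finally have "b\<^sup>2 * ip (pact s) (pact s) \<le> 0"
      using ip_self_nonneg[of "pact ([:-a, 1:] * s)"] by linarith
    then have "ip (pact s) (pact s) = 0"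
      using that(1) ip_self_nonneg[of "pact s"] by (simp add: mult_le_0_iff)
    then have "pact s = (\<lambda>_. 0)" by (rule ip_self_zero)
    moreover have s0: "s \<noteq> 0" using p(1) that by auto
    ultimately have "degree p \<le> degree s" by (intro pmin)
    moreover have "degree p = 2 + degree s"
      unfolding that(2) using s0 by (subst degree_mult_eq) (simp_all del: mult_pCons_left)
    ultimately show False by simp
  qed
  define \<Lambda> where "\<Lambda> = {x. poly p x = 0}"
  have fin: "finite \<Lambda>" using p(1) by (simp add: \<Lambda>_def poly_roots_finite)
  let ?p1 = "\<Prod>l\<in>\<Lambda>. [:-l, 1:]"
  obtain q where q: "p = ?p1 * q" using prod_linear_dvd[OF fin, of p] by (auto simp: \<Lambda>_def)
  have "degree q = 0"
  proof (rule ccontr)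
    assume "degree q \<noteq> 0"
    then have "degree q > 0" by simp
    then show False
    proof (cases rule: real_poly_factor_cases)
      case (real a)
      then have "poly p a = 0" by (simp add: q)
      then have "a \<in> \<Lambda>" by (simp add: \<Lambda>_def)
      then have e1: "?p1 = [:-a, 1:] * (\<Prod>l\<in>\<Lambda> - {a}. [:-l, 1:])" using fin by (rule prod.remove[rotated])
      obtain s where e2: "q = [:-a, 1:] * s" using real by (metis poly_eq_0_iff_dvd dvdE)
      have "p = [:-a, 1:] * ([:-a, 1:] * ((\<Prod>l\<in>\<Lambda> - {a}. [:-l, 1:]) * s))"
        unfolding q e1 unfolding e2 by (simp only: ac_simps)
      then show False by (rule no_square)
    next
      case (quad a b s)
      then have "p = [:a\<^sup>2 + b\<^sup>2, - 2 * a, 1:] * (?p1 * s)" unfolding q quad(2) by (simp only: ac_simps)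
      then show False using no_quad quad(1) by blast
    qed
  qed
  then obtain c where "q = [:c:]" by (rule degree_eq_zeroE)
  then have pc: "p = smult c ?p1" "c \<noteq> 0" using q p(1) by auto
  have "pact ?p1 x = 0" for x
    using p(2) pact_smult[of c ?p1 x] pc by simp
  then show ?thesis using fin by blast
qed

text \<open>Modulo the split annihilator a polynomial acts only through its values on
  \<open>\<Lambda>\<close>. So the Lagrange polynomials of \<open>\<Lambda>\<close> act as spectral
  projections, and the weights are squared norms of the projected root vector. The last clause lets
  any solution of the resolvent equation deliver the Stieltjes transform.\<close>

lemma spectral_decomposition:
  obtains \<Lambda> :: "real set" and w :: "real \<Rightarrow> real" where "finite \<Lambda>" "\<And>l. l \<in> \<Lambda> \<Longrightarrow> w l \<ge> 0"
    "\<And>k. (adj ^^ k) e0 rt = (\<Sum>l\<in>\<Lambda>. w l * l ^ k)"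
    "\<And>z g. Im z \<noteq> 0 \<Longrightarrow> (\<And>x. x \<in> I \<Longrightarrow> z * g x - (\<Sum>y\<in>{y \<in> I. R x y}. g y) = of_real (e0 x)) \<Longrightarrow>
       g rt = (\<Sum>l\<in>\<Lambda>. of_real (w l) / (z - of_real l))"
proof -
  obtain \<Lambda> where fin: "finite \<Lambda>" and p1: "pact (\<Prod>l\<in>\<Lambda>. [:-l, 1:]) = (\<lambda>_. 0)"
    using exists_split_annihilator by blast
  have van: "pact r = (\<lambda>_. 0)" if r: "\<And>l. l \<in> \<Lambda> \<Longrightarrow> poly r l = 0" for r
  proof -
    obtain s where "r = (\<Prod>l\<in>\<Lambda>. [:-l, 1:]) * s" using prod_linear_dvd[OF fin r] by (blast elim: dvdE)
    then show ?thesis using pact_ideal[OF p1, of s] by (simp add: mult.commute)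
  qed
  have van2: "pact r = pact s" if "\<And>l. l \<in> \<Lambda> \<Longrightarrow> poly r l = poly s l" for r s
  proof
    fix x
    have "pact (r - s) = (\<lambda>_. 0)" using that by (intro van) simp
    then show "pact r x = pact s x" using pact_diff[of r s x] by simp
  qed
  define L where "L l = smult (1 / (\<Prod>m\<in>\<Lambda> - {l}. l - m)) (\<Prod>m\<in>\<Lambda> - {l}. [:-m, 1:])" for l
  have L: "poly (L l) m = (if m = l then 1 else 0)" if "l \<in> \<Lambda>" "m \<in> \<Lambda>" for l m
  proof (cases "m = l")
    case True
    have "(\<Prod>m\<in>\<Lambda> - {l}. l - m) \<noteq> 0" using fin by auto
    then show ?thesis using True by (simp add: L_def poly_prod)
  next
    case False
    then have "(\<Prod>x\<in>\<Lambda> - {l}. m - x) = 0" using fin that by (intro prod_zero) auto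
    then show ?thesis using False by (simp add: L_def poly_prod)
  qed
  define w where "w l = pact (L l) rt" for l
  \<comment> \<open>\<open>L l\<close> and its square agree on \<open>\<Lambda>\<close>, so
    \<open>w l\<close> is a squared norm.\<close>
  have w0: "w l \<ge> 0" if "l \<in> \<Lambda>" for l
  proof -
    have "pact (L l) = pact (L l * L l)" using L that by (intro van2) auto
    then have "w l = ip (pact (L l * L l)) (pact 1)" by (simp add: w_def pact_1 ip_root)
    also have "\<dots> = ip (pact (L l)) (pact (L l * 1))" by (rule ip_pact_mult)
    finally show ?thesis using ip_self_nonneg by simp
  qed
  have interp: "pact r x = (\<Sum>l\<in>\<Lambda>. poly r l * pact (L l) x)" for r x
  proof -
    have "pact r = pact (\<Sum>l\<in>\<Lambda>. smult (poly r l) (L l))"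
    proof (rule van2)
      fix m assume m: "m \<in> \<Lambda>"
      have "poly (\<Sum>l\<in>\<Lambda>. smult (poly r l) (L l)) m = (\<Sum>l\<in>\<Lambda>. if l = m then poly r l else 0)"
        unfolding poly_sum using m L by (intro sum.cong) auto
      then show "poly r m = poly (\<Sum>l\<in>\<Lambda>. smult (poly r l) (L l)) m" using fin m by simp
    qed
    then show ?thesis by (simp add: pact_sum pact_smult)
  qed
  have mom: "(adj ^^ k) e0 rt = (\<Sum>l\<in>\<Lambda>. w l * l ^ k)" for k
    using interp[of "monom 1 k" rt] by (simp add: pact_monom poly_monom w_def mult.commute)
  have res: "g rt = (\<Sum>l\<in>\<Lambda>. of_real (w l) / (z - of_real l))"
    if z: "Im z \<noteq> 0" and g: "\<And>x. x \<in> I \<Longrightarrow> z * g x - (\<Sum>y\<in>{y \<in> I. R x y}. g y) = of_real (e0 x)"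
    for z and g :: "'i \<Rightarrow> complex"
  proof -
    \<comment> \<open>The pairing of \<open>g\<close> with \<open>q(A) e\<close>. Tested against
      \<open>q(A) e\<close>, the resolvent equation relates \<open>\<Phi> q\<close> to
      \<open>\<Phi> (X q)\<close>. On \<open>L l\<close> multiplication by \<open>X\<close> amounts
      to multiplication by \<open>l\<close>, which determines \<open>\<Phi> (L l)\<close>.\<close>
    define \<Phi> where "\<Phi> q = (\<Sum>x\<in>I. g x * of_real (pact q x))" for q
    have \<Phi>: "z * \<Phi> q - \<Phi> (pCons 0 q) = of_real (pact q rt)" for q
    proof -
      have "\<Phi> (pCons 0 q) = (\<Sum>x\<in>I. \<Sum>y\<in>{y \<in> I. R x y}. g x * of_real (pact q y))"
        unfolding \<Phi>_def pact_pCons0 adj_def by (intro sum.cong refl) (simp add: sum_distrib_left)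
      also have "\<dots> = (\<Sum>y\<in>I. \<Sum>x\<in>{x \<in> I. R x y}. g x * of_real (pact q y))"
        by (rule sum.swap_restrict[OF finI finI])
      also have "\<dots> = (\<Sum>y\<in>I. (\<Sum>x\<in>{x \<in> I. R y x}. g x) * of_real (pact q y))"
        using Rsym by (intro sum.cong refl) (auto simp: sum_distrib_right intro!: sum.cong)
      finally have "z * \<Phi> q - \<Phi> (pCons 0 q) =
          (\<Sum>x\<in>I. (z * g x - (\<Sum>y\<in>{y \<in> I. R x y}. g y)) * of_real (pact q x))"
        by (simp add: \<Phi>_def sum_distrib_left sum_subtractf left_diff_distrib mult.assoc)
      also have "\<dots> = (\<Sum>x\<in>I. of_real (pact q x * e0 x))"
        using g by (intro sum.cong refl) simp
      also have "\<dots> = of_real (ip (pact q) e0)" by (simp add: ip_def)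
      finally show ?thesis by (simp add: ip_root)
    qed
    have \<Phi>L: "\<Phi> (L l) = of_real (w l) / (z - of_real l)" if "l \<in> \<Lambda>" for l
    proof -
      have "pact (pCons 0 (L l)) = pact (smult l (L l))"
        using L that by (intro van2) auto
      then have "\<Phi> (pCons 0 (L l)) = of_real l * \<Phi> (L l)"
        by (simp add: \<Phi>_def pact_smult sum_distrib_left algebra_simps)
      then have "(z - of_real l) * \<Phi> (L l) = of_real (w l)"
        using \<Phi>[of "L l"] by (simp add: w_def algebra_simps)
      moreover have "z - of_real l \<noteq> 0" using z by (auto simp: complex_eq_iff)
      ultimately show ?thesis by (simp add: field_simps)
    qed
    have "g rt = (\<Sum>x\<in>I. if x = rt then g x else 0)" using finI rtI by simp
    also have "\<dots> = \<Phi> 1" unfolding \<Phi>_def pact_1 e0_def by (intro sum.cong) auto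
    also have "\<dots> = (\<Sum>x\<in>I. \<Sum>l\<in>\<Lambda>. g x * of_real (pact (L l) x))"
      unfolding \<Phi>_def using interp[of 1] by (simp add: sum_distrib_left)
    also have "\<dots> = (\<Sum>l\<in>\<Lambda>. \<Phi> (L l))" unfolding \<Phi>_def by (rule sum.swap)
    finally show ?thesis using \<Phi>L by simp
  qed
  show ?thesis by (rule that[of \<Lambda> w]) (fact fin, erule w0, fact mom, rule res)
qed

text \<open>Each application of the operator multiplies the sum of absolute values by at most the
  largest degree.\<close>

lemma adj_pow_bound:
  assumes C: "\<And>x. x \<in> I \<Longrightarrow> real (card {y \<in> I. R x y}) \<le> C"
  shows "(\<Sum>x\<in>I. \<bar>(adj ^^ k) e0 x\<bar>) \<le> C ^ k"
proof (induction k)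
  case 0
  have "(\<Sum>x\<in>I. \<bar>e0 x\<bar>) = (\<Sum>x\<in>I. if x = rt then 1 else 0)" by (intro sum.cong) (auto simp: e0_def)
  then show ?case using finI rtI by simp
next
  case (Suc k)
  let ?f = "(adj ^^ k) e0"
  have C0: "C \<ge> 0" using C[OF rtI] by linarith
  have "(\<Sum>x\<in>I. \<bar>adj ?f x\<bar>) \<le> (\<Sum>x\<in>I. \<Sum>y\<in>{y \<in> I. R x y}. \<bar>?f y\<bar>)"
    unfolding adj_def by (intro sum_mono) (auto intro: sum_abs)
  also have "\<dots> = (\<Sum>y\<in>I. \<Sum>x\<in>{x \<in> I. R x y}. \<bar>?f y\<bar>)"
    by (rule sum.swap_restrict[OF finI finI])
  also have "\<dots> \<le> (\<Sum>y\<in>I. C * \<bar>?f y\<bar>)"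
  proof (rule sum_mono)
    fix y assume y: "y \<in> I"
    have "{x \<in> I. R x y} = {x \<in> I. R y x}" using Rsym by auto
    then show "(\<Sum>x\<in>{x \<in> I. R x y}. \<bar>?f y\<bar>) \<le> C * \<bar>?f y\<bar>"
      using C[OF y] by (simp add: mult_right_mono)
  qed
  also have "\<dots> = C * (\<Sum>y\<in>I. \<bar>?f y\<bar>)" by (simp add: sum_distrib_left)
  also have "\<dots> \<le> C * C ^ k" using Suc C0 by (rule mult_left_mono)
  finally show ?case by simp
qed

end

section \<open>Path trees\<close>

text \<open>Vertices outside \<open>S\<close> stay in the type as isolated points, so paths and
  matching measures of subgraphs are those of an ordinary edge relation.\<close>

definition induced :: "(nat \<Rightarrow> nat \<Rightarrow> bool) \<Rightarrow> nat set \<Rightarrow> nat \<Rightarrow> nat \<Rightarrow> bool" where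
  "induced E S x y \<longleftrightarrow> E x y \<and> x \<in> S \<and> y \<in> S"

lemma is_path_singleton: "is_path E u [w] \<longleftrightarrow> w = u"
  by (auto simp: is_path_def)

lemma is_path_snoc:
  assumes "p \<noteq> []"
  shows "is_path E u (p @ [w]) \<longleftrightarrow> is_path E u p \<and> w \<notin> set p \<and> E (last p) w"
proof -
  have "(\<forall>i. Suc i < length (p @ [w]) \<longrightarrow> E ((p @ [w]) ! i) ((p @ [w]) ! Suc i)) \<longleftrightarrow>
    (\<forall>i. Suc i < length p \<longrightarrow> E (p ! i) (p ! Suc i)) \<and> E (last p) w" (is "?L \<longleftrightarrow> ?R")
  proof
    assume L: ?L
    have "E (p ! i) (p ! Suc i)" if "Suc i < length p" for i
      using L[rule_format, of i] that by (simp add: nth_append)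
    moreover have "E (last p) w"
      using L[rule_format, of "length p - 1"] assms by (simp add: nth_append last_conv_nth)
    ultimately show ?R by blast
  next
    assume R: ?R
    show ?L
    proof (intro allI impI)
      fix i assume i: "Suc i < length (p @ [w])"
      show "E ((p @ [w]) ! i) ((p @ [w]) ! Suc i)"
      proof (cases "Suc i < length p")
        case False
        then have "i = length p - 1" "Suc i = length p" using i by auto
        then show ?thesis using R assms by (simp add: nth_append last_conv_nth)
      qed (use R in \<open>simp add: nth_append\<close>)
    qed
  qed
  then show ?thesis using assms by (auto simp: is_path_def hd_append)
qed

lemma path_in_induced:
  assumes "is_path (induced E S) u p" "u \<in> S"
  shows "set p \<subseteq> S"
  using assms
proof (induction p rule: rev_induct)
  case (snoc w p)
  show ?case
  proof (cases "p = []")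
    case True
    then show ?thesis using snoc.prems by (simp add: is_path_singleton)
  next
    case False
    then have "is_path (induced E S) u p" "induced E S (last p) w" using snoc.prems by (auto simp: is_path_snoc)
    then have "set p \<subseteq> S" "w \<in> S" using snoc.IH snoc.prems(2) by (auto simp: induced_def[of E S "last p" w])
    then show ?thesis by simp
  qed
qed simp

lemma finite_paths_induced:
  assumes "finite S" "u \<in> S"
  shows "finite {p. is_path (induced E S) u p}"
proof (rule finite_subset)
  show "{p. is_path (induced E S) u p} \<subseteq> {p. set p \<subseteq> S \<and> distinct p}"
    using path_in_induced[OF _ assms(2)] by (auto simp: is_path_def)
  show "finite {p. set p \<subseteq> S \<and> distinct p}"
    using finite_subset_distinct[OF assms(1)] by simp
qed

lemma tree_adj_sym: "tree_adj p q \<Longrightarrow> tree_adj q p"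
  by (auto simp: tree_adj_def)

lemma tree_neighbours:
  assumes p: "is_path (induced E S) u (p @ [w])" and u: "u \<in> S"
  shows "{q \<in> {q. is_path (induced E S) u q}. tree_adj (p @ [w]) q} =
    (\<lambda>v. p @ [w] @ [v]) ` {v \<in> S - set p - {w}. E w v} \<union> (if p = [] then {} else {p})"
proof -
  have wS: "w \<in> S" using path_in_induced[OF p u] by auto
  have child: "is_path (induced E S) u (p @ [w] @ [v]) \<longleftrightarrow> v \<in> S - set p - {w} \<and> E w v" for v
    using is_path_snoc[of "p @ [w]" "induced E S" u v] p wS by (auto simp: induced_def[of E S w v])
  have parent: "is_path (induced E S) u p \<longleftrightarrow> p \<noteq> []"
    using p is_path_snoc[of p "induced E S" u w] by (cases "p = []") (simp_all add: is_path_def)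
  have adj: "tree_adj (p @ [w]) q \<longleftrightarrow> (\<exists>v. q = p @ [w] @ [v]) \<or> q = p" for q
    unfolding tree_adj_def by auto
  show ?thesis
  proof (intro set_eqI iffI)
    fix q assume "q \<in> {q \<in> {q. is_path (induced E S) u q}. tree_adj (p @ [w]) q}"
    then have q: "is_path (induced E S) u q" "(\<exists>v. q = p @ [w] @ [v]) \<or> q = p" using adj by auto
    from q(2) show "q \<in> (\<lambda>v. p @ [w] @ [v]) ` {v \<in> S - set p - {w}. E w v} \<union> (if p = [] then {} else {p})"
    proof
      assume "\<exists>v. q = p @ [w] @ [v]"
      then obtain v where v: "q = p @ [w] @ [v]" by blast
      then have "v \<in> {v \<in> S - set p - {w}. E w v}" using q(1) child by simp
      then show ?thesis using v by blast
    next
      assume "q = p"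
      then show ?thesis using q(1) parent by simp
    qed
  next
    fix q assume "q \<in> (\<lambda>v. p @ [w] @ [v]) ` {v \<in> S - set p - {w}. E w v} \<union> (if p = [] then {} else {p})"
    then have "(\<exists>v. q = p @ [w] @ [v] \<and> v \<in> S - set p - {w} \<and> E w v) \<or> (q = p \<and> p \<noteq> [])"
      by (auto split: if_splits)
    then show "q \<in> {q \<in> {q. is_path (induced E S) u q}. tree_adj (p @ [w]) q}"
      using child parent adj by blast
  qed
qed

section \<open>Counting walks by powers of the adjacency operator\<close>

definition walks_to :: "(nat \<Rightarrow> nat \<Rightarrow> bool) \<Rightarrow> nat \<Rightarrow> nat \<Rightarrow> nat list \<Rightarrow> nat list list set" where
  "walks_to E u k p = {ws. length ws = Suc k \<and> ws ! 0 = [u] \<and> ws ! k = p \<and>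
      (\<forall>i\<le>k. is_path E u (ws ! i)) \<and> (\<forall>i<k. tree_adj (ws ! i) (ws ! Suc i))}"

lemma closed_walks_eq: "closed_walks E u k = walks_to E u k [u]"
  by (simp add: closed_walks_def walks_to_def)

lemma walks_to_0: "walks_to E u 0 p = (if p = [u] then {[[u]]} else {})"
  by (auto simp: walks_to_def length_Suc_conv is_path_singleton)

lemma walks_to_Suc:
  "walks_to E u (Suc k) p = (if is_path E u p then
     (\<Union>q\<in>{q. is_path E u q \<and> tree_adj p q}. (\<lambda>ws. ws @ [p]) ` walks_to E u k q) else {})"
proof -
  have "ws \<in> walks_to E u (Suc k) p \<longleftrightarrow>
     is_path E u p \<and> (\<exists>q. is_path E u q \<and> tree_adj p q \<and> ws \<in> (\<lambda>ws. ws @ [p]) ` walks_to E u k q)" for ws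
  proof
    assume ws: "ws \<in> walks_to E u (Suc k) p"
    then have len: "length ws = Suc (Suc k)" by (simp add: walks_to_def)
    then obtain vs x where v: "ws = vs @ [x]" by (cases ws rule: rev_exhaust) auto
    have lv: "length vs = Suc k" using len v by simp
    have x: "x = p" using ws v lv by (simp add: walks_to_def nth_append)
    have n: "ws ! i = vs ! i" if "i \<le> k" for i using that v lv by (simp add: nth_append)
    have "is_path E u p" using ws by (auto simp: walks_to_def)
    moreover have "is_path E u (vs ! k)"
    proof -
      have "is_path E u (ws ! k)" using ws by (simp add: walks_to_def)
      then show ?thesis by (simp add: n)
    qed
    moreover have "tree_adj p (vs ! k)"
    proof -
      have "tree_adj (ws ! k) (ws ! Suc k)" "ws ! Suc k = p" using ws by (auto simp: walks_to_def)
      then show ?thesis using n[of k] by (auto intro: tree_adj_sym)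
    qed
    moreover have "vs \<in> walks_to E u k (vs ! k)"
    proof -
      have "tree_adj (vs ! i) (vs ! Suc i)" if "i < k" for i
      proof -
        have "tree_adj (ws ! i) (ws ! Suc i)" using ws that by (simp add: walks_to_def)
        then show ?thesis using n[of i] n[of "Suc i"] that by simp
      qed
      moreover have "is_path E u (vs ! i)" if "i \<le> k" for i
      proof -
        have "is_path E u (ws ! i)" using ws that by (simp add: walks_to_def)
        then show ?thesis using n[of i] that by simp
      qed
      moreover have "vs ! 0 = [u]" using ws n[of 0] by (simp add: walks_to_def)
      ultimately show ?thesis using lv by (simp add: walks_to_def)
    qed
    ultimately show "is_path E u p \<and> (\<exists>q. is_path E u q \<and> tree_adj p q \<and> ws \<in> (\<lambda>ws. ws @ [p]) ` walks_to E u k q)"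
      using v x by blast
  next
    assume "is_path E u p \<and> (\<exists>q. is_path E u q \<and> tree_adj p q \<and> ws \<in> (\<lambda>ws. ws @ [p]) ` walks_to E u k q)"
    then obtain q vs where q: "is_path E u p" "is_path E u q" "tree_adj p q" "ws = vs @ [p]" "vs \<in> walks_to E u k q"
      by blast
    have lv: "length vs = Suc k" using q by (simp add: walks_to_def)
    have n: "ws ! i = vs ! i" if "i \<le> k" for i using that q(4) lv by (simp add: nth_append)
    have n': "ws ! Suc k = p" using q(4) lv by (simp add: nth_append)
    have "tree_adj (ws ! i) (ws ! Suc i)" if "i < Suc k" for i
    proof (cases "i = k")
      case True
      then show ?thesis using n[of k] n' q by (auto simp: walks_to_def intro: tree_adj_sym)
    next
      case False
      then show ?thesis using n[of i] n[of "Suc i"] that q by (auto simp: walks_to_def)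
    qed
    moreover have "is_path E u (ws ! i)" if "i \<le> Suc k" for i
      using n[of i] n' q that by (cases "i = Suc k") (auto simp: walks_to_def)
    ultimately show "ws \<in> walks_to E u (Suc k) p"
      using n[of 0] n' lv q by (auto simp: walks_to_def)
  qed
  then show ?thesis by auto
qed

lemma finite_walks_to:
  assumes "finite {p. is_path E u p}"
  shows "finite (walks_to E u k p)"
proof (induction k arbitrary: p)
  case (Suc k)
  have "finite {q. is_path E u q \<and> tree_adj p q}" by (rule finite_subset[OF _ assms]) auto
  then show ?case using Suc by (simp add: walks_to_Suc)
qed (simp add: walks_to_0)

lemma finite_graph_operator_paths:
  assumes "finite {p. is_path E u p}"
  shows "finite_graph_operator {p. is_path E u p} tree_adj [u]"
  by unfold_locales (auto simp: assms is_path_singleton intro: tree_adj_sym)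

text \<open>Only closed walks matter in the end, but the recursion on the last step needs an
  arbitrary endpoint \<open>p\<close>; hence \<open>walks_to\<close>.\<close>

lemma adj_pow_walks:
  assumes fin: "finite {p. is_path E u p}"
  shows "(finite_graph_operator.adj {p. is_path E u p} tree_adj ^^ k) (finite_graph_operator.e0 [u]) p
     = real (card (walks_to E u k p))"
proof (induction k arbitrary: p)
  interpret finite_graph_operator "{p. is_path E u p}" tree_adj "[u]"
    by (rule finite_graph_operator_paths[OF fin])
  case 0
  then show ?case by (simp add: e0_def walks_to_0)
next
  interpret finite_graph_operator "{p. is_path E u p}" tree_adj "[u]"
    by (rule finite_graph_operator_paths[OF fin])
  case (Suc k)
  have f: "finite {q. is_path E u q \<and> tree_adj p q}" by (rule finite_subset[OF _ fin]) auto
  have "card (\<Union>q\<in>{q. is_path E u q \<and> tree_adj p q}. (\<lambda>ws. ws @ [p]) ` walks_to E u k q)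
     = (\<Sum>q\<in>{q. is_path E u q \<and> tree_adj p q}. card ((\<lambda>ws. ws @ [p]) ` walks_to E u k q))"
    by (rule card_UN_disjoint) (use f finite_walks_to[OF fin] in \<open>auto simp: walks_to_def\<close>)
  also have "\<dots> = (\<Sum>q\<in>{q. is_path E u q \<and> tree_adj p q}. card (walks_to E u k q))"
    by (intro sum.cong refl card_image) (auto simp: inj_on_def)
  finally have "real (card (walks_to E u (Suc k) p)) =
      (if p \<in> {p. is_path E u p} then \<Sum>y\<in>{y \<in> {p. is_path E u p}. tree_adj p y}. real (card (walks_to E u k y)) else 0)"
    by (simp add: walks_to_Suc)
  also have "\<dots> = adj ((adj ^^ k) e0) p" by (simp only: adj_def[of "(adj ^^ k) e0" p] Suc)
  finally show ?case by simp
qed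

text \<open>At most \<open>D\<close> children and one parent. The resulting \<open>Suc D\<close> is
  the bound for walk counts and supports from here on.\<close>

lemma card_tree_neighbours:
  assumes u: "u \<in> S" and p: "is_path (induced E S) u p"
    and deg: "\<And>v. v \<in> S \<Longrightarrow> card {w \<in> S. E v w} \<le> D" and fin: "finite S"
  shows "card {q \<in> {q. is_path (induced E S) u q}. tree_adj p q} \<le> Suc D"
proof -
  obtain p' w where p': "p = p' @ [w]" using p by (cases p rule: rev_exhaust) (auto simp: is_path_def)
  have w: "w \<in> S" using path_in_induced[OF p u] p' by auto
  have "card ((\<lambda>v. p' @ [w] @ [v]) ` {v \<in> S - set p' - {w}. E w v}) \<le> card {v \<in> S - set p' - {w}. E w v}"
    by (rule card_image_le) (use fin in auto)
  also have "\<dots> \<le> card {v \<in> S. E w v}" by (rule card_mono) (use fin in auto)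
  also have "\<dots> \<le> D" by (rule deg[OF w])
  finally have "card ((\<lambda>v. p' @ [w] @ [v]) ` {v \<in> S - set p' - {w}. E w v}) \<le> D" .
  moreover have "card (if p' = [] then {} else {p'}) \<le> 1" by simp
  ultimately show ?thesis unfolding p' tree_neighbours[OF p[unfolded p'] u]
    by (intro order.trans[OF card_Un_le]) linarith
qed

text \<open>At a path \<open>p' @ [w]\<close> this is the expansion of \<open>S - set p'\<close> at
  \<open>w\<close>: the children give the sum over neighbours, the parent gives the term of
  \<open>S - set p'\<close> itself. The root has no parent, and the value \<open>1\<close> of that
  term becomes the right-hand side.\<close>

lemma resolvent_path_tree:
  assumes sym: "symp E" and fin: "finite S" and u: "u \<in> S" and z: "Im z > 0"
    and p: "is_path (induced E S) u p"
  defines "g \<equiv> \<lambda>p. matching_poly E z (S - set p) / matching_poly E z S"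
  shows "z * g p - (\<Sum>q\<in>{q \<in> {q. is_path (induced E S) u q}. tree_adj p q}. g q) = (if p = [u] then 1 else 0)"
proof -
  let ?m = "matching_poly E z"
  obtain p' w where p': "p = p' @ [w]" using p by (cases p rule: rev_exhaust) (auto simp: is_path_def)
  let ?T = "S - set p'"
  have w: "w \<in> ?T" using path_in_induced[OF p u] p' p by (auto simp: is_path_def)
  have nz: "?m S \<noteq> 0" using matching_poly_nonzero[OF sym z fin] .
  have exp: "?m ?T = z * ?m (?T - {w}) - (\<Sum>v\<in>{v \<in> ?T - {w}. E w v}. ?m (?T - {w} - {v}))"
    by (rule matching_poly_expand[OF sym]) (use fin w in auto)
  have "(\<Sum>q\<in>{q \<in> {q. is_path (induced E S) u q}. tree_adj p q}. g q)
    = (\<Sum>q\<in>(\<lambda>v. p' @ [w] @ [v]) ` {v \<in> ?T - {w}. E w v}. g q) + (\<Sum>q\<in>(if p' = [] then {} else {p'}). g q)"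
    unfolding p' tree_neighbours[OF p[unfolded p'] u]
    by (rule sum.union_disjoint) (use fin in auto)
  also have "(\<Sum>q\<in>(\<lambda>v. p' @ [w] @ [v]) ` {v \<in> ?T - {w}. E w v}. g q)
     = (\<Sum>v\<in>{v \<in> ?T - {w}. E w v}. ?m (?T - {w} - {v})) / ?m S"
    by (subst sum.reindex) (auto simp: inj_on_def g_def sum_divide_distrib insert_commute set_diff_eq
        intro!: sum.cong arg_cong2[of _ _ _ _ "(/)"] arg_cong[of _ _ ?m])
  also have "(\<Sum>q\<in>(if p' = [] then {} else {p'}). g q) = ?m ?T / ?m S - (if p = [u] then 1 else 0)"
  proof (cases "p' = []")
    case True
    then have "p = [u]" using p p' by (simp add: is_path_singleton)
    then show ?thesis using True nz by simp
  next
    case False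
    then show ?thesis using p' by (simp add: g_def)
  qed
  finally have sum: "(\<Sum>q\<in>{q \<in> {q. is_path (induced E S) u q}. tree_adj p q}. g q) =
      (\<Sum>v\<in>{v \<in> ?T - {w}. E w v}. ?m (?T - {w} - {v})) / ?m S + (?m ?T / ?m S - (if p = [u] then 1 else 0))" .
  have gp: "g p = ?m (?T - {w}) / ?m S"
    by (auto simp: g_def p' intro!: arg_cong2[of _ _ _ _ "(/)"] arg_cong[of _ _ ?m])
  show ?thesis unfolding sum gp unfolding exp by (simp add: diff_divide_distrib)
qed

lemma finite_spectral_measure:
  assumes sym: "symp E" and fin: "finite S" and u: "u \<in> S"
    and deg: "\<And>v. v \<in> S \<Longrightarrow> card {w \<in> S. E v w} \<le> D"
  obtains \<Lambda> :: "real set" and w :: "real \<Rightarrow> real" where "finite \<Lambda>" "\<And>l. l \<in> \<Lambda> \<Longrightarrow> w l \<ge> 0"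
    "\<And>k. real (card (closed_walks (induced E S) u k)) = (\<Sum>l\<in>\<Lambda>. w l * l ^ k)"
    "\<And>k. real (card (closed_walks (induced E S) u k)) \<le> real (Suc D) ^ k"
    "\<And>z. Im z > 0 \<Longrightarrow> mratio E z S u = (\<Sum>l\<in>\<Lambda>. of_real (w l) / (z - of_real l))"
proof -
  let ?I = "{p. is_path (induced E S) u p}"
  have finI: "finite ?I" by (rule finite_paths_induced[OF fin u])
  interpret finite_graph_operator ?I tree_adj "[u]" by (rule finite_graph_operator_paths[OF finI])
  obtain \<Lambda> w where L: "finite \<Lambda>" "\<And>l. l \<in> \<Lambda> \<Longrightarrow> w l \<ge> 0"
    "\<And>k. (adj ^^ k) e0 [u] = (\<Sum>l\<in>\<Lambda>. w l * l ^ k)"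
    "\<And>z g. Im z \<noteq> 0 \<Longrightarrow> (\<And>x. x \<in> ?I \<Longrightarrow> z * g x - (\<Sum>y\<in>{y \<in> ?I. tree_adj x y}. g y) = of_real (e0 x)) \<Longrightarrow>
       g [u] = (\<Sum>l\<in>\<Lambda>. of_real (w l) / (z - of_real l))"
    using spectral_decomposition by blast
  show thesis
  proof (rule that[OF L(1,2)])
    show c: "real (card (closed_walks (induced E S) u k)) = (\<Sum>l\<in>\<Lambda>. w l * l ^ k)" for k
      using L(3) adj_pow_walks[OF finI] by (simp add: closed_walks_eq)
    have "\<bar>(adj ^^ k) e0 [u]\<bar> \<le> real (Suc D) ^ k" for k
    proof -
      have "\<bar>(adj ^^ k) e0 [u]\<bar> \<le> (\<Sum>x\<in>?I. \<bar>(adj ^^ k) e0 x\<bar>)"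
        using rtI finI by (intro member_le_sum) auto
      also have "\<dots> \<le> real (Suc D) ^ k"
      proof (rule adj_pow_bound)
        fix x assume "x \<in> ?I"
        then show "real (card {y \<in> ?I. tree_adj x y}) \<le> real (Suc D)"
          using card_tree_neighbours[of u S E x D] u deg fin by (simp only: of_nat_le_iff mem_Collect_eq)
      qed
      finally show ?thesis .
    qed
    then show "real (card (closed_walks (induced E S) u k)) \<le> real (Suc D) ^ k" for k
      using adj_pow_walks[OF finI, of k "[u]"] by (metis abs_of_nat closed_walks_eq)
    show "mratio E z S u = (\<Sum>l\<in>\<Lambda>. of_real (w l) / (z - of_real l))" if z: "Im z > 0" for z
    proof -
      have "matching_poly E z (S - set [u]) / matching_poly E z S = (\<Sum>l\<in>\<Lambda>. of_real (w l) / (z - of_real l))"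
      proof (rule L(4)[of z "\<lambda>p. matching_poly E z (S - set p) / matching_poly E z S"])
        show "Im z \<noteq> 0" using z by simp
        fix x assume "x \<in> ?I"
        then have "is_path (induced E S) u x" by simp
        from resolvent_path_tree[OF sym fin u z this]
        show "z * (matching_poly E z (S - set x) / matching_poly E z S) -
         (\<Sum>y\<in>{y \<in> ?I. tree_adj x y}. matching_poly E z (S - set y) / matching_poly E z S) =
         complex_of_real (e0 x)" by (simp add: e0_def)
      qed
      then show ?thesis by (simp add: mratio_def[OF sym z])
    qed
  qed
qed

section \<open>Matching measures of infinite graphs\<close>

text \<open>The property that characterises \<open>matching_measure\<close>, for an arbitrary moment
  sequence, so that it serves finite approximations and limits alike.\<close>

definition has_moments :: "(nat \<Rightarrow> real) \<Rightarrow> real measure \<Rightarrow> bool" where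
  "has_moments c \<mu> \<longleftrightarrow> prob_space \<mu> \<and> sets \<mu> = sets borel \<and>
     (\<forall>k. integrable \<mu> (\<lambda>x. x ^ k) \<and> (\<integral>x. x ^ k \<partial>\<mu>) = c k)"

lemma has_moments_real_distribution: "has_moments c \<mu> \<Longrightarrow> real_distribution \<mu>"
  by (simp add: has_moments_def real_distribution_def real_distribution_axioms_def)

text \<open>Taylor expansion of the characteristic function. At the even order \<open>2 * n\<close>
  the absolute moment in the error term is the moment itself.\<close>

lemma char_moments:
  assumes "has_moments c \<mu>" and C: "\<And>k. c k \<le> C ^ k"
  shows "cmod (char \<mu> t - (\<Sum>k\<le>2 * n. ((\<i> * t) ^ k / fact k) * c k)) \<le> 2 * (inverse (fact (2 * n)) * (\<bar>t\<bar> * C) ^ (2 * n))"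
proof -
  interpret real_distribution \<mu> by (rule has_moments_real_distribution[OF assms(1)])
  have m: "integrable \<mu> (\<lambda>x. x ^ k)" "(\<integral>x. x ^ k \<partial>\<mu>) = c k" for k
    using assms(1) by (auto simp: has_moments_def)
  have "cmod (char \<mu> t - (\<Sum>k\<le>2 * n. ((\<i> * t) ^ k / fact k) * c k))
     \<le> (2 * \<bar>t\<bar> ^ (2 * n) / fact (2 * n)) * expectation (\<lambda>x. \<bar>x\<bar> ^ (2 * n))"
    using char_approx1[of "2 * n" t] m by simp
  also have "expectation (\<lambda>x. \<bar>x\<bar> ^ (2 * n)) = c (2 * n)"
    using m(2)[of "2 * n"] by (simp add: power_even_abs)
  also have "(2 * \<bar>t\<bar> ^ (2 * n) / fact (2 * n)) * c (2 * n) \<le> (2 * \<bar>t\<bar> ^ (2 * n) / fact (2 * n)) * C ^ (2 * n)"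
    using C by (intro mult_left_mono) auto
  finally show ?thesis by (simp add: power_mult_distrib divide_inverse algebra_simps)
qed

lemma power_fact_even_tendsto_0: "(\<lambda>n. inverse (fact (2 * n)) * x ^ (2 * n)) \<longlonglongrightarrow> (0 :: real)"
proof -
  have "(\<lambda>n. inverse (fact n) * x ^ n) \<longlonglongrightarrow> 0"
    by (rule summable_LIMSEQ_zero[OF summable_exp])
  then show ?thesis
    by (rule LIMSEQ_subseq_LIMSEQ[unfolded comp_def, where f = "\<lambda>n. 2 * n"]) (simp add: strict_mono_def)
qed

text \<open>The Taylor error is uniform in \<open>n\<close>, so for a given accuracy only finitely
  many moments matter, and these eventually agree.\<close>

lemma char_moments_tendsto:
  assumes M: "\<And>n. has_moments (c' n) (\<mu>' n)" and M0: "has_moments c \<mu>"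
    and C: "\<And>n k. c' n k \<le> C ^ k" "\<And>k. c k \<le> C ^ k"
    and ev: "\<And>k. eventually (\<lambda>n. c' n k = c k) sequentially"
  shows "(\<lambda>n. char (\<mu>' n) t) \<longlonglongrightarrow> char \<mu> t"
proof (rule tendstoI)
  fix e :: real assume e: "e > 0"
  let ?b = "\<lambda>n. 2 * (inverse (fact (2 * n)) * (\<bar>t\<bar> * C) ^ (2 * n))"
  have b0: "?b \<longlonglongrightarrow> 2 * 0" by (intro tendsto_mult tendsto_const power_fact_even_tendsto_0)
  then have "eventually (\<lambda>n. ?b n < e / 2) sequentially"
    using order_tendstoD(2)[OF b0, of "e / 2"] e by simp
  then obtain N where N: "?b N < e / 2" by (auto simp: eventually_sequentially)
  have "eventually (\<lambda>n. \<forall>k\<in>{..2 * N}. c' n k = c k) sequentially"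
    by (intro eventually_ball_finite) (auto intro: ev)
  then show "eventually (\<lambda>n. dist (char (\<mu>' n) t) (char \<mu> t) < e) sequentially"
  proof eventually_elim
    case (elim n)
    then have eq: "(\<Sum>k\<le>2 * N. ((\<i> * t) ^ k / fact k) * c' n k) = (\<Sum>k\<le>2 * N. ((\<i> * t) ^ k / fact k) * c k)"
      by (intro sum.cong) auto
    have "dist (char (\<mu>' n) t) (char \<mu> t) \<le> dist (char (\<mu>' n) t) (\<Sum>k\<le>2 * N. ((\<i> * t) ^ k / fact k) * c k)
       + dist (char \<mu> t) (\<Sum>k\<le>2 * N. ((\<i> * t) ^ k / fact k) * c k)" by (rule dist_triangle2)
    also have "\<dots> \<le> ?b N + ?b N"
      using char_moments[OF M[of n] C(1), of t N] char_moments[OF M0 C(2), of t N]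
      unfolding eq dist_norm by (rule add_mono)
    also have "\<dots> < e" using N by simp
    finally show ?case .
  qed
qed

lemma has_moments_unique:
  assumes "has_moments c \<mu>" "has_moments c \<nu>" and C: "\<And>k. c k \<le> C ^ k"
  shows "\<mu> = \<nu>"
proof (rule Levy_uniqueness)
  show "real_distribution \<mu>" "real_distribution \<nu>" using assms has_moments_real_distribution by auto
  show "char \<mu> = char \<nu>"
  proof
    fix t
    have "(\<lambda>n::nat. char \<mu> t) \<longlonglongrightarrow> char \<nu> t"
      by (rule char_moments_tendsto[where c = c and c' = "\<lambda>_. c" and C = C]) (use assms in auto)
    then show "char \<mu> t = char \<nu> t" by (simp add: LIMSEQ_const_iff)
  qed
qed

lemma moments_weak_conv:
  assumes "\<And>n. has_moments (c' n) (\<mu>' n)" and "has_moments c \<mu>"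
    and "\<And>n k. c' n k \<le> C ^ k" "\<And>k. c k \<le> C ^ k"
    and "\<And>k. eventually (\<lambda>n. c' n k = c k) sequentially"
  shows "weak_conv_m \<mu>' \<mu>"
  by (intro levy_continuity char_moments_tendsto[OF assms] has_moments_real_distribution[OF assms(1)]
      has_moments_real_distribution[OF assms(2)])

text \<open>A common bounded support gives tightness and so a weakly convergent subsequence. Weak
  convergence only tests bounded continuous functions; support and moments are therefore read off
  through the truncations \<open>?g\<close> and \<open>?h\<close>.\<close>

lemma moments_limit_exists:
  fixes C :: real
  assumes M: "\<And>n. has_moments (c' n) (\<mu>' n)" and supp: "\<And>n. AE x in \<mu>' n. \<bar>x\<bar> \<le> C" and C0: "C \<ge> 0"
    and ev: "\<And>k. eventually (\<lambda>n. c' n k = c k) sequentially"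
  obtains \<mu> where "has_moments c \<mu>" "AE x in \<mu>. \<bar>x\<bar> \<le> C"
proof -
  have rd: "real_distribution (\<mu>' n)" for n by (rule has_moments_real_distribution[OF M])
  have "tight \<mu>'"
    unfolding tight_def
  proof (intro conjI allI impI)
    show "real_distribution (\<mu>' n)" for n by (rule rd)
    fix e :: real assume e: "e > 0"
    \<comment> \<open>Tightness is stated with half-open intervals, so the left end moves from
      \<open>- C\<close> to \<open>- C - 1\<close>.\<close>
    have "measure (\<mu>' n) {- C - 1<..C} > 1 - e" for n
    proof -
      interpret real_distribution "\<mu>' n" by (rule rd)
      have "AE x in \<mu>' n. x \<in> {- C - 1<..C}" using supp[of n] by eventually_elim auto
      then have "prob {- C - 1<..C} = 1" by (subst prob_eq_1) auto
      then show ?thesis using e by simp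
    qed
    then show "\<exists>a b. a < b \<and> (\<forall>n. 1 - e < measure (\<mu>' n) {a<..b})"
      using C0 by (intro exI[of _ "- C - 1"] exI[of _ C]) auto
  qed
  then obtain r \<mu> where r: "strict_mono r" "real_distribution \<mu>" "weak_conv_m (\<mu>' \<circ> r) \<mu>"
    using tight_imp_convergent_subsubsequence[of \<mu>' "\<lambda>n. n"] by (auto simp: strict_mono_def comp_def)
  have rd': "real_distribution ((\<mu>' \<circ> r) n)" for n using rd by simp
  interpret \<mu>: real_distribution \<mu> by (rule r)
  \<comment> \<open>Bounded, continuous, and zero exactly on the interval from \<open>- C\<close> to
    \<open>C\<close>.\<close>
  let ?g = "\<lambda>x::real. min 1 (max 0 (\<bar>x\<bar> - C))"
  have g_int: "(\<lambda>n. integral\<^sup>L ((\<mu>' \<circ> r) n) ?g) \<longlonglongrightarrow> integral\<^sup>L \<mu> ?g"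
    by (rule weak_conv_imp_integral_bdd_continuous_conv[OF rd' r(2,3), of _ 1]) (auto intro!: continuous_intros)
  have "integral\<^sup>L (\<mu>' n) ?g = 0" for n
  proof -
    have "integral\<^sup>L (\<mu>' n) ?g = integral\<^sup>L (\<mu>' n) (\<lambda>_. 0)"
    proof (rule integral_cong_AE)
      interpret real_distribution "\<mu>' n" by (rule rd)
      show "?g \<in> borel_measurable (\<mu>' n)" by measurable
      show "AE x in \<mu>' n. ?g x = 0" using supp[of n] by eventually_elim auto
    qed auto
    then show ?thesis by simp
  qed
  then have "integral\<^sup>L \<mu> ?g = 0" using g_int by (simp add: LIMSEQ_const_iff)
  moreover have "integrable \<mu> ?g" by (rule \<mu>.integrable_const_bound[of _ 1]) auto
  ultimately have "AE x in \<mu>. ?g x = 0"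
    by (subst (asm) integral_nonneg_eq_0_iff_AE) auto
  then have AE: "AE x in \<mu>. \<bar>x\<bar> \<le> C" by eventually_elim (auto simp: min_def max_def split: if_splits)
  let ?h = "\<lambda>k x::real. (max (- C) (min C x)) ^ k"
  have hb: "\<bar>?h k x\<bar> \<le> C ^ k" for k x
    unfolding power_abs using C0 by (intro power_mono) auto
  have h_eq: "AE x in \<nu>. ?h k x = x ^ k" if "AE x in \<nu>. \<bar>x\<bar> \<le> C" for \<nu> k
    using that
  proof eventually_elim
    case (elim x)
    then have "max (- C) (min C x) = x" by auto
    then show ?case by simp
  qed
  have "has_moments c \<mu>"
    unfolding has_moments_def
  proof (intro conjI allI)
    show "prob_space \<mu>" by unfold_locales
    show "sets \<mu> = sets borel" by simp
    fix k
    have "integrable \<mu> (?h k)" using hb by (intro \<mu>.integrable_const_bound[of _ "C ^ k"]) auto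
    then show int: "integrable \<mu> (\<lambda>x. x ^ k)"
      by (rule integrable_cong_AE_imp) (use h_eq[OF AE] in auto)
    have "(\<lambda>n. integral\<^sup>L ((\<mu>' \<circ> r) n) (?h k)) \<longlonglongrightarrow> integral\<^sup>L \<mu> (?h k)"
      by (rule weak_conv_imp_integral_bdd_continuous_conv[OF rd' r(2,3), of _ "C ^ k"])
        (auto intro!: continuous_intros hb)
    moreover have "integral\<^sup>L ((\<mu>' \<circ> r) n) (?h k) = c' (r n) k" for n
    proof -
      interpret real_distribution "\<mu>' (r n)" by (rule rd)
      have "integral\<^sup>L (\<mu>' (r n)) (?h k) = integral\<^sup>L (\<mu>' (r n)) (\<lambda>x. x ^ k)"
        by (rule integral_cong_AE) (use h_eq[OF supp] in auto)
      then show ?thesis using M by (simp add: has_moments_def)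
    qed
    moreover have "(\<lambda>n. c' (r n) k) \<longlonglongrightarrow> c k"
    proof -
      have "(\<lambda>n. c' n k) \<longlonglongrightarrow> c k" using ev[of k] by (rule tendsto_eventually)
      then show ?thesis using LIMSEQ_subseq_LIMSEQ[OF _ r(1)] by (simp add: comp_def)
    qed
    ultimately have "integral\<^sup>L \<mu> (?h k) = c k" using LIMSEQ_unique by simp
    moreover have "integral\<^sup>L \<mu> (?h k) = integral\<^sup>L \<mu> (\<lambda>x. x ^ k)"
      by (rule integral_cong_AE) (use h_eq[OF AE] in auto)
    ultimately show "integral\<^sup>L \<mu> (\<lambda>x. x ^ k) = c k" by simp
  qed
  then show thesis using that AE by blast
qed

text \<open>The support clause records \<open>w x > 0\<close>, since \<open>\<Lambda>\<close> may
  contain points without mass, which no moment bound can locate.\<close>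

lemma discrete_measure:
  fixes w :: "real \<Rightarrow> real"
  assumes fin: "finite \<Lambda>" and w: "\<And>l. l \<in> \<Lambda> \<Longrightarrow> w l \<ge> 0" and w1: "(\<Sum>l\<in>\<Lambda>. w l) = 1"
  obtains \<mu> where "has_moments (\<lambda>k. \<Sum>l\<in>\<Lambda>. w l * l ^ k) \<mu>" "AE x in \<mu>. x \<in> \<Lambda> \<and> w x > 0"
    "\<And>f :: real \<Rightarrow> complex. f \<in> borel_measurable borel \<Longrightarrow> integral\<^sup>L \<mu> f = (\<Sum>l\<in>\<Lambda>. of_real (w l) * f l)"
proof -
  define v where "v x = (if x \<in> \<Lambda> then w x else 0)" for x
  have v0: "v x \<ge> 0" for x using w by (simp add: v_def)
  have "(\<integral>\<^sup>+x. ennreal (v x) \<partial>count_space UNIV) = (\<Sum>x\<in>\<Lambda>. ennreal (v x))"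
    by (rule nn_integral_count_space'[OF fin]) (auto simp: v_def)
  also have "\<dots> = ennreal (\<Sum>x\<in>\<Lambda>. w x)" using w by (subst sum_ennreal[symmetric]) (auto simp: v_def)
  finally have v1: "(\<integral>\<^sup>+x. ennreal (v x) \<partial>count_space UNIV) = 1" using w1 by simp
  define p where "p = embed_pmf v"
  have p: "pmf p x = v x" for x unfolding p_def by (rule pmf_embed_pmf[OF v0 v1])
  have sp: "set_pmf p \<subseteq> \<Lambda>" by (auto simp: set_pmf_eq p v_def)
  \<comment> \<open>In \<open>measure_pmf p\<close> every set is measurable; the image under the
    identity has the sigma-algebra \<open>borel\<close> that \<open>has_moments\<close>
    demands.\<close>
  define \<mu> where "\<mu> = distr (measure_pmf p) borel (\<lambda>x. x)"
  have int: "integral\<^sup>L \<mu> f = (\<Sum>l\<in>\<Lambda>. w l *\<^sub>R f l)" if "f \<in> borel_measurable borel"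
    for f :: "real \<Rightarrow> 'b::{banach, second_countable_topology}"
  proof -
    have "integral\<^sup>L \<mu> f = (\<integral>x. f x \<partial>measure_pmf p)" unfolding \<mu>_def by (rule integral_distr) (use that in auto)
    also have "\<dots> = (\<Sum>l\<in>\<Lambda>. pmf p l *\<^sub>R f l)" by (rule integral_measure_pmf[OF fin]) (use sp in auto)
    finally show ?thesis by (simp add: p v_def cong: sum.cong)
  qed
  have intg: "integrable \<mu> f" if "f \<in> borel_measurable borel" for f :: "real \<Rightarrow> real"
    unfolding \<mu>_def using that
    by (subst integrable_distr_eq) (auto intro!: integrable_measure_pmf_finite finite_subset[OF sp fin])
  show thesis
  proof
    show "has_moments (\<lambda>k. \<Sum>l\<in>\<Lambda>. w l * l ^ k) \<mu>"
      unfolding has_moments_def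
    proof (intro conjI allI)
      show "prob_space \<mu>" unfolding \<mu>_def by (rule measure_pmf.prob_space_distr) simp
      show "sets \<mu> = sets borel" by (simp add: \<mu>_def)
      show "integrable \<mu> (\<lambda>x. x ^ k)" for k by (rule intg) measurable
      show "(\<integral>x. x ^ k \<partial>\<mu>) = (\<Sum>l\<in>\<Lambda>. w l * l ^ k)" for k
        using int[of "\<lambda>x::real. x ^ k"] by simp
    qed
    show "AE x in \<mu>. x \<in> \<Lambda> \<and> w x > 0"
    proof -
      have "AE x in measure_pmf p. x \<in> \<Lambda> \<and> w x > 0"
        unfolding AE_measure_pmf_iff
      proof
        fix x assume x: "x \<in> set_pmf p"
        then have "x \<in> \<Lambda>" "v x \<noteq> 0" using sp by (auto simp: set_pmf_iff p)
        then show "x \<in> \<Lambda> \<and> w x > 0" using w[of x] by (simp add: v_def)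
      qed
      moreover have "{x \<in> space borel. x \<in> \<Lambda> \<and> w x > 0} \<in> sets borel"
        by (rule borel_closed, rule finite_imp_closed) (use fin in auto)
      ultimately show ?thesis unfolding \<mu>_def by (subst AE_distr_iff) auto
    qed
    show "integral\<^sup>L \<mu> f = (\<Sum>l\<in>\<Lambda>. of_real (w l) * f l)" if "f \<in> borel_measurable borel" for f :: "real \<Rightarrow> complex"
      using int[OF that] by (simp add: scaleR_conv_of_real)
  qed
qed

lemma borel_measurable_resolvent [measurable]: "(\<lambda>x::real. 1 / (z - complex_of_real x)) \<in> borel_measurable borel"
  by measurable

lemma finite_matching_measure:
  assumes sym: "symp E" and fin: "finite S" and u: "u \<in> S"
    and deg: "\<And>v. v \<in> S \<Longrightarrow> card {w \<in> S. E v w} \<le> D"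
  obtains \<mu> where "has_moments (\<lambda>k. real (card (closed_walks (induced E S) u k))) \<mu>"
    "AE x in \<mu>. \<bar>x\<bar> \<le> real (Suc D)"
    "\<And>z. Im z > 0 \<Longrightarrow> mratio E z S u = (\<integral>x. 1 / (z - complex_of_real x) \<partial>\<mu>)"
proof -
  obtain \<Lambda> w where L: "finite \<Lambda>" "\<And>l. l \<in> \<Lambda> \<Longrightarrow> w l \<ge> (0::real)"
    "\<And>k. real (card (closed_walks (induced E S) u k)) = (\<Sum>l\<in>\<Lambda>. w l * l ^ k)"
    "\<And>k. real (card (closed_walks (induced E S) u k)) \<le> real (Suc D) ^ k"
    "\<And>z. Im z > 0 \<Longrightarrow> mratio E z S u = (\<Sum>l\<in>\<Lambda>. of_real (w l) / (z - of_real l))"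
    by (rule finite_spectral_measure[where E = E and S = S and u = u and D = D])
      (rule sym, rule fin, rule u, erule deg, rule that, assumption+)
  have "closed_walks (induced E S) u 0 = {[[u]]}" by (simp add: closed_walks_eq walks_to_0)
  then have "(\<Sum>l\<in>\<Lambda>. w l) = 1" using L(3)[of 0] by simp
  from discrete_measure[OF L(1,2) this] obtain \<mu> where
    mu: "has_moments (\<lambda>k. \<Sum>l\<in>\<Lambda>. w l * l ^ k) \<mu>" "AE x in \<mu>. x \<in> \<Lambda> \<and> w x > 0"
    "\<And>f :: real \<Rightarrow> complex. f \<in> borel_measurable borel \<Longrightarrow> integral\<^sup>L \<mu> f = (\<Sum>l\<in>\<Lambda>. of_real (w l) * f l)"
    by blast
  \<comment> \<open>A point of positive mass outside the interval would make the moments of order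
    \<open>2 * n\<close> outgrow \<open>Suc D ^ (2 * n)\<close>.\<close>
  have bound: "\<bar>l\<bar> \<le> real (Suc D)" if l: "l \<in> \<Lambda>" "w l > 0" for l
  proof (rule ccontr)
    assume "\<not> \<bar>l\<bar> \<le> real (Suc D)"
    then have "1 < \<bar>l / real (Suc D)\<bar>" by (simp add: abs_divide less_divide_eq)
    then have "1 < \<bar>l / real (Suc D)\<bar>\<^sup>2" by (rule one_less_power) simp
    then have r: "1 < (l / real (Suc D))\<^sup>2" by (simp only: power2_abs)
    obtain n where n: "1 / w l < ((l / real (Suc D))\<^sup>2) ^ n" using real_arch_pow[OF r] by blast
    have "w l * l ^ (2 * n) \<le> (\<Sum>l\<in>\<Lambda>. w l * l ^ (2 * n))"
      using L(1,2) l by (intro member_le_sum) auto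
    also have "\<dots> \<le> real (Suc D) ^ (2 * n)" using L(3,4) by metis
    finally have "w l * (l ^ (2 * n) / real (Suc D) ^ (2 * n)) \<le> 1" by (simp add: field_simps)
    then have "w l * ((l / real (Suc D))\<^sup>2) ^ n \<le> 1" by (simp add: power_mult[symmetric] power_divide)
    then show False using n l by (simp add: field_simps)
  qed
  show thesis
  proof
    show "has_moments (\<lambda>k. real (card (closed_walks (induced E S) u k))) \<mu>" using mu(1) L(3) by simp
    show "AE x in \<mu>. \<bar>x\<bar> \<le> real (Suc D)" using mu(2) by eventually_elim (use bound in auto)
    show "mratio E z S u = (\<integral>x. 1 / (z - complex_of_real x) \<partial>\<mu>)" if "Im z > 0" for z
      using mu(3)[OF borel_measurable_resolvent[of z]] L(5)[OF that] by simp
  qed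
qed

section \<open>Exhaustion of an infinite graph by finite induced subgraphs\<close>

definition is_locally_bounded :: "(nat \<Rightarrow> nat \<Rightarrow> bool) \<Rightarrow> nat set \<Rightarrow> nat \<Rightarrow> bool" where
  "is_locally_bounded E V D \<longleftrightarrow> (\<forall>v\<in>V. finite {w \<in> V. E v w} \<and> card {w \<in> V. E v w} \<le> D)"

lemma is_locally_bounded_subset:
  assumes "is_locally_bounded E V D" "W \<subseteq> V"
  shows "is_locally_bounded E W D"
  unfolding is_locally_bounded_def
proof (intro ballI conjI)
  fix v assume "v \<in> W"
  then have f: "finite {w \<in> V. E v w}" "card {w \<in> V. E v w} \<le> D" using assms by (auto simp: is_locally_bounded_def)
  have s: "{w \<in> W. E v w} \<subseteq> {w \<in> V. E v w}" using assms by auto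
  show "finite {w \<in> W. E v w}" using s f finite_subset by blast
  show "card {w \<in> W. E v w} \<le> D" using card_mono[OF f(1) s] f(2) by simp
qed

lemma closed_walks_vertices:
  assumes "ws \<in> closed_walks (induced E V) u k" and "u \<in> V"
  shows "\<exists>N. \<forall>n\<ge>N. ws \<in> closed_walks (induced E (V \<inter> {..<n})) u k"
proof -
  let ?A = "\<Union>p\<in>set ws. set p"
  have "finite ?A" by auto
  then obtain N where N: "\<forall>x\<in>?A. x < N" using finite_nat_set_iff_bounded by blast
  have "ws \<in> closed_walks (induced E (V \<inter> {..<n})) u k" if "n \<ge> N" for n
  proof -
    have "is_path (induced E (V \<inter> {..<n})) u (ws ! i)" if i: "i \<le> k" for i
    proof -
      have p: "is_path (induced E V) u (ws ! i)" and mem: "ws ! i \<in> set ws"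
        using assms(1) i by (auto simp: closed_walks_def)
      have "x < n" if "x \<in> set (ws ! i)" for x using N mem that \<open>n \<ge> N\<close> by fastforce
      then have lt: "ws ! i ! j < n" if "j < length (ws ! i)" for j using that nth_mem by blast
      show ?thesis unfolding is_path_def
      proof (intro conjI allI impI)
        fix j assume j: "Suc j < length (ws ! i)"
        then have "induced E V (ws ! i ! j) (ws ! i ! Suc j)" using p unfolding is_path_def by blast
        then show "induced E (V \<inter> {..<n}) (ws ! i ! j) (ws ! i ! Suc j)"
          using lt[of j] lt[of "Suc j"] j unfolding induced_def by simp
      qed (use p in \<open>auto simp: is_path_def\<close>)
    qed
    then show ?thesis using assms(1) by (simp add: closed_walks_def)
  qed
  then show ?thesis by blast
qed

lemma is_path_mono:
  assumes "is_path E u p" "\<And>x y. E x y \<Longrightarrow> E' x y"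
  shows "is_path E' u p"
  using assms by (simp add: is_path_def)

lemma closed_walks_mono:
  assumes "\<And>x y. E x y \<Longrightarrow> E' x y"
  shows "closed_walks E u k \<subseteq> closed_walks E' u k"
  unfolding closed_walks_def using is_path_mono[OF _ assms] by auto

text \<open>Each closed walk visits finitely many vertices and lies in all large truncations. These
  have a common bound on the number of walks, so the full set is finite and reached at a finite
  stage.\<close>

lemma closed_walks_eventually:
  assumes sym: "symp E" and u: "u \<in> V" and deg: "is_locally_bounded E V D"
  shows "eventually (\<lambda>n. closed_walks (induced E (V \<inter> {..<n})) u k = closed_walks (induced E V) u k) sequentially"
    and "card (closed_walks (induced E V) u k) \<le> Suc D ^ k"
proof -
  let ?W = "\<lambda>n. closed_walks (induced E (V \<inter> {..<n})) u k" and ?V = "closed_walks (induced E V) u k"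
  have bound: "card (?W n) \<le> Suc D ^ k" and finW: "finite (?W n)" if "n > u" for n
  proof -
    have uS: "u \<in> V \<inter> {..<n}" using u that by simp
    have b: "is_locally_bounded E (V \<inter> {..<n}) D" by (rule is_locally_bounded_subset[OF deg]) auto
    have "real (card (?W n)) \<le> real (Suc D) ^ k"
      by (rule finite_spectral_measure[OF sym _ uS, where D = D]) (use b in \<open>auto simp: is_locally_bounded_def\<close>)
    then show "card (?W n) \<le> Suc D ^ k" by (simp flip: of_nat_power of_nat_Suc)
    show "finite (?W n)"
      unfolding closed_walks_eq by (intro finite_walks_to finite_paths_induced) (use uS in auto)
  qed
  have unif: "\<exists>N. \<forall>n\<ge>N. A \<subseteq> ?W n" if "finite A" "A \<subseteq> ?V" for A
  proof -
    from closed_walks_vertices[OF _ u] that(2)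
    have "\<forall>ws\<in>A. eventually (\<lambda>n. ws \<in> ?W n) sequentially" by (auto simp: eventually_sequentially)
    then have "eventually (\<lambda>n. \<forall>ws\<in>A. ws \<in> ?W n) sequentially" using that(1) by (simp add: eventually_ball_finite)
    then show ?thesis by (auto simp: eventually_sequentially)
  qed
  have "finite ?V \<and> card ?V \<le> Suc D ^ k"
  proof (rule finite_if_finite_subsets_card_bdd)
    fix A assume A: "A \<subseteq> ?V" "finite A"
    obtain N where N: "\<And>n. n \<ge> N \<Longrightarrow> A \<subseteq> ?W n" using unif[OF A(2,1)] by blast
    have "card A \<le> card (?W (max N (Suc u)))" by (intro card_mono finW N) auto
    also have "\<dots> \<le> Suc D ^ k" by (intro bound) auto
    finally show "card A \<le> Suc D ^ k" .
  qed
  then show "card ?V \<le> Suc D ^ k" and fin: "eventually (\<lambda>n. ?W n = ?V) sequentially"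
  proof -
    assume W0: "finite ?V \<and> card ?V \<le> Suc D ^ k"
    then show "card ?V \<le> Suc D ^ k" by blast
    have "?W n \<subseteq> ?V" for n by (rule closed_walks_mono) (auto simp: induced_def)
    moreover obtain N where "\<forall>n\<ge>N. ?V \<subseteq> ?W n" using unif[of ?V] W0 by blast
    ultimately show "eventually (\<lambda>n. ?W n = ?V) sequentially" unfolding eventually_sequentially by blast
  qed
qed

lemma matching_measure_eqI:
  assumes "has_moments (\<lambda>k. real (card (closed_walks E u k))) \<mu>"
    and "\<And>k. real (card (closed_walks E u k)) \<le> C ^ k"
  shows "matching_measure E u = \<mu>"
  unfolding matching_measure_def has_moments_def[symmetric]
  by (rule the_equality) (rule assms(1), rule has_moments_unique[OF _ assms(1) assms(2)])

text \<open>The moments of the truncations stabilise, so their measures converge weakly to a measure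
  with the limit moments, which uniqueness identifies with \<open>matching_measure\<close>. The
  resolvent kernel is bounded and continuous for \<open>Im z > 0\<close>, so the ratios converge as
  well.\<close>

lemma matching_measure_props:
  assumes sym: "symp E" and u: "u \<in> V" and deg: "is_locally_bounded E V D"
  shows "has_moments (\<lambda>k. real (card (closed_walks (induced E V) u k))) (matching_measure (induced E V) u)" (is ?moments)
    and "AE x in matching_measure (induced E V) u. \<bar>x\<bar> \<le> real (Suc D)" (is ?AE)
    and "Im z > 0 \<Longrightarrow> (\<lambda>n. mratio E z (V \<inter> {..<n}) u) \<longlonglongrightarrow>
           (\<integral>x. 1 / (z - complex_of_real x) \<partial>matching_measure (induced E V) u)"
proof -
  \<comment> \<open>The shift by \<open>Suc u\<close> puts \<open>u\<close> into every
    \<open>S n\<close>; \<open>LIMSEQ_offset\<close> removes it at the end.\<close>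
  define S where "S n = V \<inter> {..<Suc u + n}" for n
  have S: "finite (S n)" "u \<in> S n" "is_locally_bounded E (S n) D" for n
    using u by (auto simp: S_def intro: is_locally_bounded_subset[OF deg])
  let ?c' = "\<lambda>n k. real (card (closed_walks (induced E (S n)) u k))"
  let ?c = "\<lambda>k. real (card (closed_walks (induced E V) u k))"
  have "\<exists>\<mu>. has_moments (?c' n) \<mu> \<and> (AE x in \<mu>. \<bar>x\<bar> \<le> real (Suc D)) \<and>
    (\<forall>z. Im z > 0 \<longrightarrow> mratio E z (S n) u = (\<integral>x. 1 / (z - complex_of_real x) \<partial>\<mu>))" for n
    by (rule finite_matching_measure[OF sym S(1,2), where D = D]) (use S(3) in \<open>auto simp: is_locally_bounded_def\<close>)
  then obtain \<mu>' where \<mu>': "\<And>n. has_moments (?c' n) (\<mu>' n)" "\<And>n. AE x in \<mu>' n. \<bar>x\<bar> \<le> real (Suc D)"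
    "\<And>n z. Im z > 0 \<Longrightarrow> mratio E z (S n) u = (\<integral>x. 1 / (z - complex_of_real x) \<partial>\<mu>' n)" by metis
  have ev: "eventually (\<lambda>n. ?c' n k = ?c k) sequentially" for k
  proof -
    have "eventually (\<lambda>n. closed_walks (induced E (V \<inter> {..<n})) u k = closed_walks (induced E V) u k) sequentially"
      by (rule closed_walks_eventually[OF sym u deg])
    then have "eventually (\<lambda>n. closed_walks (induced E (V \<inter> {..<n + Suc u})) u k = closed_walks (induced E V) u k) sequentially"
      by (rule sequentially_offset)
    then show ?thesis unfolding S_def by eventually_elim (simp add: add.commute)
  qed
  have C: "?c k \<le> real (Suc D) ^ k" for k
    using closed_walks_eventually(2)[OF sym u deg, of k] by (simp flip: of_nat_power of_nat_Suc)
  have C': "?c' n k \<le> real (Suc D) ^ k" for n k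
  proof -
    have b: "is_locally_bounded E (S n) D" by (rule S)
    from closed_walks_eventually(2)[OF sym S(2) b, of k] show ?thesis by (simp flip: of_nat_power of_nat_Suc)
  qed
  obtain \<mu> where \<mu>: "has_moments ?c \<mu>" "AE x in \<mu>. \<bar>x\<bar> \<le> real (Suc D)"
    using moments_limit_exists[OF \<mu>'(1,2) _ ev] by auto
  have eq: "matching_measure (induced E V) u = \<mu>" by (rule matching_measure_eqI[OF \<mu>(1) C])
  show ?moments ?AE using \<mu> eq by auto
  have wc: "weak_conv_m \<mu>' \<mu>" by (rule moments_weak_conv[OF \<mu>'(1) \<mu>(1) C' C ev])
  assume z: "Im z > 0"
  have zx: "z - complex_of_real x \<noteq> 0" for x using z by (auto simp: complex_eq_iff)
  have "(\<lambda>n. integral\<^sup>L (\<mu>' n) (\<lambda>x. 1 / (z - complex_of_real x))) \<longlonglongrightarrow> integral\<^sup>L \<mu> (\<lambda>x. 1 / (z - complex_of_real x))"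
  proof (rule weak_conv_imp_integral_bdd_continuous_conv[of \<mu>' \<mu> _ "1 / Im z"])
    show "real_distribution (\<mu>' n)" "real_distribution \<mu>" for n
      by (rule has_moments_real_distribution, rule \<mu>')+ (rule has_moments_real_distribution, rule \<mu>)
    show "weak_conv_m \<mu>' \<mu>" by (rule wc)
    show "isCont (\<lambda>x. 1 / (z - complex_of_real x)) x" for x using zx by (auto intro!: continuous_intros)
    show "norm (1 / (z - complex_of_real x)) \<le> 1 / Im z" for x
    proof -
      have "Im z \<le> cmod (z - complex_of_real x)" using abs_Im_le_cmod[of "z - complex_of_real x"] by simp
      then show ?thesis using z by (auto simp: norm_divide intro!: divide_left_mono mult_pos_pos)
    qed
  qed
  then have "(\<lambda>n. mratio E z (S n) u) \<longlonglongrightarrow> (\<integral>x. 1 / (z - complex_of_real x) \<partial>matching_measure (induced E V) u)"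
    using \<mu>'(3)[OF z] eq by simp
  then have "(\<lambda>n. mratio E z (V \<inter> {..<n + Suc u}) u) \<longlonglongrightarrow> (\<integral>x. 1 / (z - complex_of_real x) \<partial>matching_measure (induced E V) u)"
    by (simp add: S_def add.commute)
  then show "(\<lambda>n. mratio E z (V \<inter> {..<n}) u) \<longlonglongrightarrow>
           (\<integral>x. 1 / (z - complex_of_real x) \<partial>matching_measure (induced E V) u)"
    by (rule LIMSEQ_offset)
qed

section \<open>Atoms of critical graphs\<close>

definition atom :: "(nat \<Rightarrow> nat \<Rightarrow> bool) \<Rightarrow> real \<Rightarrow> nat set \<Rightarrow> nat \<Rightarrow> real" where
  "atom E \<theta> V u = measure (matching_measure (induced E V) u) {\<theta>}"

text \<open>At \<open>z = \<theta> + \<i> * \<epsilon>\<close> the kernel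
  \<open>\<i> * \<epsilon> / (z - x)\<close> is bounded by \<open>1\<close>, equals \<open>1\<close>
  at \<open>x = \<theta>\<close> and tends to \<open>0\<close> elsewhere, so its integral tends to
  the atom.\<close>

definition scaled_green :: "(nat \<Rightarrow> nat \<Rightarrow> bool) \<Rightarrow> complex \<Rightarrow> nat set \<Rightarrow> nat \<Rightarrow> complex" where
  "scaled_green E z V u =
     \<i> * of_real (Im z) * (\<integral>x. 1 / (z - complex_of_real x) \<partial>matching_measure (induced E V) u)"

definition scaled_ratio :: "(nat \<Rightarrow> nat \<Rightarrow> bool) \<Rightarrow> complex \<Rightarrow> nat set \<Rightarrow> nat \<Rightarrow> complex" where
  "scaled_ratio E z S u = \<i> * of_real (Im z) * mratio E z S u"

context
  fixes E :: "nat \<Rightarrow> nat \<Rightarrow> bool"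
  assumes sym: "symp E"
begin

context
  fixes z :: complex and S :: "nat set"
  assumes z: "Im z > 0" and fin: "finite S"
begin

private abbreviation "A \<equiv> scaled_ratio E z"
private abbreviation "m \<equiv> mratio E z"

lemma Re_scaled: "Re (A T u) = - (Im z * Im (m T u))" and cmod_scaled: "cmod (A T u) = Im z * cmod (m T u)"
  using z by (simp_all add: scaled_ratio_def norm_mult)

lemma scaled_ratio_sym: "A S a * A (S - {a}) b = A S b * A (S - {b}) a"
  using mratio_sym[OF sym z fin, of a b] by (simp add: scaled_ratio_def algebra_simps)

text \<open>The factor \<open>(Im z)\<^sup>3\<close> is used up by the three ratios on the left. The
  right has one ratio, so \<open>(Im z)\<^sup>2\<close> survives and forces the limit to
  \<open>0\<close>.\<close>

lemma scaled_ratio_adjacent: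
  assumes "u \<in> S" "v \<in> S" "u \<noteq> v" "E u v"
  shows "(cmod (A S u))\<^sup>2 * Re (A (S - {u}) v) \<le> (Im z)\<^sup>2 * Re (A S u)"
proof -
  have "(cmod (m S u))\<^sup>2 * (- Im (m (S - {u}) v)) \<le> - Im (m S u)"
    by (rule mratio_adjacent[OF sym z fin assms])
  then have "(Im z) ^ 3 * ((cmod (m S u))\<^sup>2 * (- Im (m (S - {u}) v))) \<le> (Im z) ^ 3 * (- Im (m S u))"
    using z by (intro mult_left_mono) auto
  then show ?thesis by (simp add: Re_scaled cmod_scaled power_mult_distrib power2_eq_square power3_eq_cube algebra_simps)
qed

lemma sum_scaled_ratio_le:
  assumes "u \<in> S" "F \<subseteq> S - {u}"
  shows "(cmod (A S u))\<^sup>2 + (\<Sum>v\<in>F. cmod (A S u * (A S v - A (S - {u}) v))) \<le> Re (A S u)"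
proof -
  have "(Im z)\<^sup>2 * ((cmod (m S u))\<^sup>2 + (\<Sum>v\<in>F. cmod (m S u * (m S v - m (S - {u}) v)))) \<le> (Im z)\<^sup>2 * (- Im (m S u) / Im z)"
    by (intro mult_left_mono sum_mratio_le[OF sym z fin assms]) auto
  also have "(Im z)\<^sup>2 * (- Im (m S u) / Im z) = Re (A S u)" using z by (simp add: Re_scaled power2_eq_square)
  also have "(Im z)\<^sup>2 * ((cmod (m S u))\<^sup>2 + (\<Sum>v\<in>F. cmod (m S u * (m S v - m (S - {u}) v))))
     = (cmod (A S u))\<^sup>2 + (\<Sum>v\<in>F. (Im z)\<^sup>2 * cmod (m S u * (m S v - m (S - {u}) v)))"
    by (simp add: cmod_scaled power_mult_distrib distrib_left sum_distrib_left)
  also have "(\<Sum>v\<in>F. (Im z)\<^sup>2 * cmod (m S u * (m S v - m (S - {u}) v)))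
     = (\<Sum>v\<in>F. cmod (A S u * (A S v - A (S - {u}) v)))"
  proof (rule sum.cong[OF refl])
    fix v
    have "A S u * (A S v - A (S - {u}) v) = - (of_real (Im z))\<^sup>2 * (m S u * (m S v - m (S - {u}) v))"
      by (simp add: scaled_ratio_def algebra_simps power2_eq_square)
    then show "(Im z)\<^sup>2 * cmod (m S u * (m S v - m (S - {u}) v)) = cmod (A S u * (A S v - A (S - {u}) v))"
      by (simp add: norm_mult norm_power)
  qed
  finally show ?thesis .
qed

lemma scaled_ratio_three_le:
  assumes "a \<in> S" "b \<in> S" "c \<in> S" "a \<noteq> c" "a \<noteq> b" "b \<noteq> c" and t: "t > 0"
  shows "cmod (A S b * A S a * A (S - {a}) c - A S b * A (S - {b}) a * A (S - {a} - {b}) c)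
    \<le> t * Re (A S b) + ((cmod (A S a))\<^sup>2 * Re (A (S - {a}) b) + (cmod (A S c))\<^sup>2 * Re (A (S - {c}) b)) / t"
proof -
  let ?X = "m S b * m S a * m (S - {a}) c - m S b * m (S - {b}) a * m (S - {a} - {b}) c"
  have "A S b * A S a * A (S - {a}) c - A S b * A (S - {b}) a * A (S - {a} - {b}) c
     = (\<i> * of_real (Im z)) ^ 3 * ?X"
    by (simp add: scaled_ratio_def algebra_simps power3_eq_cube)
  then have "cmod (A S b * A S a * A (S - {a}) c - A S b * A (S - {b}) a * A (S - {a} - {b}) c) = (Im z) ^ 3 * cmod ?X"
    using z by (simp add: norm_mult norm_power)
  \<comment> \<open>With the weight \<open>t / Im z\<close> both terms, multiplied by
    \<open>(Im z)\<^sup>3\<close>, consist of scaled ratios only.\<close>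
  also have "\<dots> \<le> (Im z) ^ 3 * (t / Im z * (- Im (m S b) / Im z)
      + ((cmod (m S a))\<^sup>2 * (- Im (m (S - {a}) b) / Im z) + (cmod (m S c))\<^sup>2 * (- Im (m (S - {c}) b) / Im z)) / (t / Im z))"
    using z t assms by (intro mult_left_mono mratio_three_le[OF sym z fin]) auto
  also have "\<dots> = t * Re (A S b) + ((cmod (A S a))\<^sup>2 * Re (A (S - {a}) b) + (cmod (A S c))\<^sup>2 * Re (A (S - {c}) b)) / t"
    using z t by (simp add: Re_scaled cmod_scaled power2_eq_square power3_eq_cube field_simps)
  finally show ?thesis .
qed

end

lemma scaled_ratio_tendsto:
  assumes "u \<in> V" "is_locally_bounded E V D" "Im z > 0"
  shows "(\<lambda>n. scaled_ratio E z (V \<inter> {..<n}) u) \<longlonglongrightarrow> scaled_green E z V u"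
  unfolding scaled_ratio_def scaled_green_def
  by (intro tendsto_mult tendsto_const matching_measure_props(3)[OF sym assms])

section \<open>Passage to atoms: first along the truncations, then
  \<open>\<epsilon> \<rightarrow> 0\<close>\<close>

definition approach :: "real \<Rightarrow> nat \<Rightarrow> complex" where
  "approach \<theta> n = Complex \<theta> (inverse (real (Suc n)))"

lemma Im_approach: "Im (approach \<theta> n) > 0" by (simp add: approach_def)

lemma scaled_green_tendsto:
  assumes "u \<in> V" "is_locally_bounded E V D"
  shows "(\<lambda>n. scaled_green E (approach \<theta> n) V u) \<longlonglongrightarrow> complex_of_real (atom E \<theta> V u)"
proof -
  let ?\<mu> = "matching_measure (induced E V) u"
  interpret real_distribution ?\<mu>
    by (rule has_moments_real_distribution[OF matching_measure_props(1)[OF sym assms]])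
  let ?s = "\<lambda>n x. \<i> * of_real (Im (approach \<theta> n)) * (1 / (approach \<theta> n - complex_of_real x))"
  have Im0: "(\<lambda>n. complex_of_real (Im (approach \<theta> n))) \<longlonglongrightarrow> of_real 0"
    unfolding approach_def complex.sel by (intro tendsto_of_real LIMSEQ_inverse_real_of_nat)
  have appr: "approach \<theta> n = of_real \<theta> + \<i> * of_real (Im (approach \<theta> n))" for n
    unfolding approach_def complex.sel by (rule Complex_eq)
  have conv: "(\<lambda>n. ?s n x) \<longlonglongrightarrow> of_real (indicator {\<theta>} x)" for x
  proof (cases "x = \<theta>")
    case True
    have "?s n x = 1" for n
    proof -
      have "approach \<theta> n - complex_of_real x = \<i> * of_real (Im (approach \<theta> n))"
        using arg_cong[OF appr[of n], of "\<lambda>w. w - complex_of_real x"] True by simp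
      then show ?thesis using Im_approach[of \<theta> n] by simp
    qed
    then show ?thesis using True by simp
  next
    case False
    have "(\<lambda>n. \<i> * of_real (Im (approach \<theta> n)) * (1 / (of_real \<theta> + \<i> * of_real (Im (approach \<theta> n)) - complex_of_real x)))
      \<longlonglongrightarrow> \<i> * of_real 0 * (1 / (of_real \<theta> + \<i> * of_real 0 - complex_of_real x))"
      using False by (intro tendsto_intros Im0) auto
    then show ?thesis using False unfolding appr[symmetric] by simp
  qed
  have bound: "norm (?s n x) \<le> 1" for n x
  proof -
    have "Im (approach \<theta> n) \<le> cmod (approach \<theta> n - complex_of_real x)"
      using abs_Im_le_cmod[of "approach \<theta> n - complex_of_real x"] by simp
    then show ?thesis using Im_approach[of \<theta> n] by (auto simp: norm_mult norm_divide divide_le_eq)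
  qed
  have "(\<lambda>n. integral\<^sup>L ?\<mu> (?s n)) \<longlonglongrightarrow> integral\<^sup>L ?\<mu> (\<lambda>x. complex_of_real (indicator {\<theta>} x))"
    by (rule integral_dominated_convergence[where w = "\<lambda>_. 1"]) (use conv bound in auto)
  moreover have "integral\<^sup>L ?\<mu> (?s n) = scaled_green E (approach \<theta> n) V u" for n
    unfolding scaled_green_def by (rule integral_mult_right_zero)
  moreover have "integral\<^sup>L ?\<mu> (\<lambda>x. complex_of_real (indicator {\<theta>} x)) = of_real (atom E \<theta> V u)"
    unfolding integral_complex_of_real atom_def by simp
  ultimately show ?thesis by simp
qed

lemma atom_nonneg: "atom E \<theta> V u \<ge> 0"
  by (simp add: atom_def)

context
  fixes V :: "nat set" and D :: nat and \<theta> :: real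
  assumes lb: "is_locally_bounded E V D"
begin

private abbreviation "p \<equiv> atom E \<theta>"
private abbreviation "g \<equiv> scaled_green E"

lemma Diff_Int_lessThan: "V \<inter> {..<n} - {a} = (V - {a}) \<inter> {..<n}" "V \<inter> {..<n} - {a} - {b} = (V - {a} - {b}) \<inter> {..<n}"
  by auto

lemma ratio_lim:
  assumes "W \<subseteq> V" "u \<in> W"
  shows "(\<lambda>n. scaled_ratio E (approach \<theta> k) (W \<inter> {..<n}) u) \<longlonglongrightarrow> g (approach \<theta> k) W u"
  by (rule scaled_ratio_tendsto[OF assms(2) is_locally_bounded_subset[OF lb assms(1)] Im_approach])

lemma green_lim:
  assumes "W \<subseteq> V" "u \<in> W"
  shows "(\<lambda>k. g (approach \<theta> k) W u) \<longlonglongrightarrow> of_real (p W u)"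
  by (rule scaled_green_tendsto[OF assms(2) is_locally_bounded_subset[OF lb assms(1)]])

text \<open>The factor \<open>(Im z)\<^sup>2\<close> in \<open>scaled_ratio_adjacent\<close> leaves
  \<open>(p V u)\<^sup>2 * p (V - {u}) v \<le> 0\<close> in the limit.\<close>

lemma atom_adjacent:
  assumes "u \<in> V" "v \<in> V" "u \<noteq> v" "E u v" "p V u > 0"
  shows "p (V - {u}) v = 0"
proof -
  have 1: "(cmod (g (approach \<theta> k) V u))\<^sup>2 * Re (g (approach \<theta> k) (V - {u}) v)
      \<le> (Im (approach \<theta> k))\<^sup>2 * Re (g (approach \<theta> k) V u)" for k
  proof (rule LIMSEQ_le)
    let ?z = "approach \<theta> k"
    show "(\<lambda>n. (cmod (scaled_ratio E ?z (V \<inter> {..<n}) u))\<^sup>2 * Re (scaled_ratio E ?z ((V - {u}) \<inter> {..<n}) v))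
      \<longlonglongrightarrow> (cmod (g ?z V u))\<^sup>2 * Re (g ?z (V - {u}) v)"
      using assms by (intro tendsto_intros ratio_lim) auto
    show "(\<lambda>n. (Im ?z)\<^sup>2 * Re (scaled_ratio E ?z (V \<inter> {..<n}) u)) \<longlonglongrightarrow> (Im ?z)\<^sup>2 * Re (g ?z V u)"
      using assms by (intro tendsto_intros ratio_lim) auto
    show "\<exists>N. \<forall>n\<ge>N. (cmod (scaled_ratio E ?z (V \<inter> {..<n}) u))\<^sup>2 * Re (scaled_ratio E ?z ((V - {u}) \<inter> {..<n}) v)
       \<le> (Im ?z)\<^sup>2 * Re (scaled_ratio E ?z (V \<inter> {..<n}) u)"
      unfolding Diff_Int_lessThan[symmetric] using assms
      by (intro exI[of _ "Suc (max u v)"] allI impI scaled_ratio_adjacent Im_approach) auto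
  qed
  have Im0: "(\<lambda>k. Im (approach \<theta> k)) \<longlonglongrightarrow> 0"
    unfolding approach_def complex.sel by (rule LIMSEQ_inverse_real_of_nat)
  have "(cmod (of_real (p V u)))\<^sup>2 * Re (of_real (p (V - {u}) v)) \<le> 0\<^sup>2 * Re (of_real (p V u))"
  proof (rule LIMSEQ_le[OF _ _ exI[of _ 0]])
    show "(\<lambda>k. (cmod (g (approach \<theta> k) V u))\<^sup>2 * Re (g (approach \<theta> k) (V - {u}) v))
        \<longlonglongrightarrow> (cmod (of_real (p V u)))\<^sup>2 * Re (of_real (p (V - {u}) v))"
      using assms by (intro tendsto_intros green_lim) auto
    show "(\<lambda>k. (Im (approach \<theta> k))\<^sup>2 * Re (g (approach \<theta> k) V u)) \<longlonglongrightarrow> 0\<^sup>2 * Re (of_real (p V u))"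
      using assms by (intro tendsto_intros green_lim Im0) auto
  qed (use 1 in auto)
  then have "(p V u)\<^sup>2 * p (V - {u}) v \<le> 0" by simp
  then show ?thesis using assms(5) atom_nonneg[of \<theta> "V - {u}" v] by (auto simp: mult_le_0_iff)
qed

text \<open>Its use: for essential \<open>a\<close> and \<open>b\<close>, deleting \<open>a\<close>
  makes \<open>b\<close> inessential exactly if deleting \<open>b\<close> makes \<open>a\<close>
  inessential.\<close>

lemma atom_sym:
  assumes "a \<in> V" "b \<in> V" "a \<noteq> b"
  shows "p V a * p (V - {a}) b = p V b * p (V - {b}) a"
proof -
  have 1: "g (approach \<theta> k) V a * g (approach \<theta> k) (V - {a}) b = g (approach \<theta> k) V b * g (approach \<theta> k) (V - {b}) a" for k
  proof (rule LIMSEQ_unique)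
    let ?z = "approach \<theta> k"
    let ?f = "\<lambda>n. scaled_ratio E ?z (V \<inter> {..<n}) a * scaled_ratio E ?z ((V - {a}) \<inter> {..<n}) b"
    show "?f \<longlonglongrightarrow> g ?z V a * g ?z (V - {a}) b" using assms by (intro tendsto_intros ratio_lim) auto
    have "?f = (\<lambda>n. scaled_ratio E ?z (V \<inter> {..<n}) b * scaled_ratio E ?z ((V - {b}) \<inter> {..<n}) a)"
      unfolding Diff_Int_lessThan[symmetric] by (intro ext scaled_ratio_sym Im_approach) auto
    moreover have "\<dots> \<longlonglongrightarrow> g ?z V b * g ?z (V - {b}) a" using assms by (intro tendsto_intros ratio_lim) auto
    ultimately show "?f \<longlonglongrightarrow> g ?z V b * g ?z (V - {b}) a" by simp
  qed
  have "complex_of_real (p V a) * of_real (p (V - {a}) b) = of_real (p V b) * of_real (p (V - {b}) a)"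
  proof (rule LIMSEQ_unique)
    show "(\<lambda>k. g (approach \<theta> k) V a * g (approach \<theta> k) (V - {a}) b) \<longlonglongrightarrow> of_real (p V a) * of_real (p (V - {a}) b)"
      using assms by (intro tendsto_intros green_lim) auto
    show "(\<lambda>k. g (approach \<theta> k) V a * g (approach \<theta> k) (V - {a}) b) \<longlonglongrightarrow> of_real (p V b) * of_real (p (V - {b}) a)"
      unfolding 1 using assms by (intro tendsto_intros green_lim) auto
  qed
  then show ?thesis by (simp flip: of_real_mult)
qed

lemma sum_atom_le:
  assumes "u \<in> V" "F \<subseteq> V - {u}" "finite F"
  shows "(p V u)\<^sup>2 + (\<Sum>v\<in>F. p V u * \<bar>p V v - p (V - {u}) v\<bar>) \<le> p V u"
proof -
  have 1: "(cmod (g (approach \<theta> k) V u))\<^sup>2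
      + (\<Sum>v\<in>F. cmod (g (approach \<theta> k) V u * (g (approach \<theta> k) V v - g (approach \<theta> k) (V - {u}) v)))
      \<le> Re (g (approach \<theta> k) V u)" for k
  proof (rule LIMSEQ_le)
    let ?z = "approach \<theta> k"
    show "(\<lambda>n. (cmod (scaled_ratio E ?z (V \<inter> {..<n}) u))\<^sup>2
        + (\<Sum>v\<in>F. cmod (scaled_ratio E ?z (V \<inter> {..<n}) u *
           (scaled_ratio E ?z (V \<inter> {..<n}) v - scaled_ratio E ?z ((V - {u}) \<inter> {..<n}) v))))
      \<longlonglongrightarrow> (cmod (g ?z V u))\<^sup>2 + (\<Sum>v\<in>F. cmod (g ?z V u * (g ?z V v - g ?z (V - {u}) v)))"
      using assms by (intro tendsto_intros ratio_lim) auto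
    show "(\<lambda>n. Re (scaled_ratio E ?z (V \<inter> {..<n}) u)) \<longlonglongrightarrow> Re (g ?z V u)"
      using assms by (intro tendsto_intros ratio_lim) auto
    obtain N where N: "\<forall>x\<in>insert u F. x < N"
      using finite_nat_set_iff_bounded[of "insert u F"] assms by blast
    have "(cmod (scaled_ratio E ?z (V \<inter> {..<n}) u))\<^sup>2
        + (\<Sum>v\<in>F. cmod (scaled_ratio E ?z (V \<inter> {..<n}) u *
           (scaled_ratio E ?z (V \<inter> {..<n}) v - scaled_ratio E ?z ((V - {u}) \<inter> {..<n}) v)))
        \<le> Re (scaled_ratio E ?z (V \<inter> {..<n}) u)" if "n \<ge> N" for n
    proof -
      have "F \<subseteq> V \<inter> {..<n} - {u}" "u \<in> V \<inter> {..<n}" using N that assms by fastforce+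
      then show ?thesis unfolding Diff_Int_lessThan[symmetric]
        by (intro sum_scaled_ratio_le Im_approach) auto
    qed
    then show "\<exists>N. \<forall>n\<ge>N. (cmod (scaled_ratio E ?z (V \<inter> {..<n}) u))\<^sup>2
        + (\<Sum>v\<in>F. cmod (scaled_ratio E ?z (V \<inter> {..<n}) u *
           (scaled_ratio E ?z (V \<inter> {..<n}) v - scaled_ratio E ?z ((V - {u}) \<inter> {..<n}) v)))
        \<le> Re (scaled_ratio E ?z (V \<inter> {..<n}) u)" by blast
  qed
  have "(cmod (of_real (p V u)))\<^sup>2 + (\<Sum>v\<in>F. cmod (of_real (p V u) * (of_real (p V v) - of_real (p (V - {u}) v))))
     \<le> Re (of_real (p V u))"
  proof (rule LIMSEQ_le[OF _ _ exI[of _ 0]])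
    show "(\<lambda>k. (cmod (g (approach \<theta> k) V u))\<^sup>2
      + (\<Sum>v\<in>F. cmod (g (approach \<theta> k) V u * (g (approach \<theta> k) V v - g (approach \<theta> k) (V - {u}) v)))) \<longlonglongrightarrow>
      (cmod (of_real (p V u)))\<^sup>2 + (\<Sum>v\<in>F. cmod (of_real (p V u) * (of_real (p V v) - of_real (p (V - {u}) v))))"
      using assms by (intro tendsto_intros green_lim) auto
    show "(\<lambda>k. Re (g (approach \<theta> k) V u)) \<longlonglongrightarrow> Re (of_real (p V u))"
      using assms by (intro tendsto_intros green_lim) auto
  qed (use 1 in auto)
  moreover have "cmod (of_real (p V u) * (of_real (p V v) - of_real (p (V - {u}) v))) = p V u * \<bar>p V v - p (V - {u}) v\<bar>" for v
    by (simp add: norm_mult atom_nonneg flip: of_real_diff)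
  ultimately show ?thesis by simp
qed

lemma atom_three_le:
  assumes "a \<in> V" "b \<in> V" "c \<in> V" "a \<noteq> c" "a \<noteq> b" "b \<noteq> c" and t: "t > 0"
  shows "\<bar>p V b * p V a * p (V - {a}) c - p V b * p (V - {b}) a * p (V - {a} - {b}) c\<bar>
    \<le> t * p V b + ((p V a)\<^sup>2 * p (V - {a}) b + (p V c)\<^sup>2 * p (V - {c}) b) / t"
proof -
  have 1: "cmod (g (approach \<theta> k) V b * g (approach \<theta> k) V a * g (approach \<theta> k) (V - {a}) c
      - g (approach \<theta> k) V b * g (approach \<theta> k) (V - {b}) a * g (approach \<theta> k) (V - {a} - {b}) c)
    \<le> t * Re (g (approach \<theta> k) V b) + ((cmod (g (approach \<theta> k) V a))\<^sup>2 * Re (g (approach \<theta> k) (V - {a}) b)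
        + (cmod (g (approach \<theta> k) V c))\<^sup>2 * Re (g (approach \<theta> k) (V - {c}) b)) / t" for k
  proof (rule LIMSEQ_le)
    let ?r = "\<lambda>W n u. scaled_ratio E (approach \<theta> k) (W \<inter> {..<n}) u"
    let ?z = "approach \<theta> k"
    show "(\<lambda>n. cmod (?r V n b * ?r V n a * ?r (V - {a}) n c - ?r V n b * ?r (V - {b}) n a * ?r (V - {a} - {b}) n c))
       \<longlonglongrightarrow> cmod (g ?z V b * g ?z V a * g ?z (V - {a}) c - g ?z V b * g ?z (V - {b}) a * g ?z (V - {a} - {b}) c)"
      using assms by (intro tendsto_intros ratio_lim) auto
    show "(\<lambda>n. t * Re (?r V n b) + ((cmod (?r V n a))\<^sup>2 * Re (?r (V - {a}) n b)
        + (cmod (?r V n c))\<^sup>2 * Re (?r (V - {c}) n b)) / t)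
       \<longlonglongrightarrow> t * Re (g ?z V b) + ((cmod (g ?z V a))\<^sup>2 * Re (g ?z (V - {a}) b)
        + (cmod (g ?z V c))\<^sup>2 * Re (g ?z (V - {c}) b)) / t"
      using assms by (intro tendsto_intros ratio_lim) auto
    show "\<exists>N. \<forall>n\<ge>N. cmod (?r V n b * ?r V n a * ?r (V - {a}) n c - ?r V n b * ?r (V - {b}) n a * ?r (V - {a} - {b}) n c)
      \<le> t * Re (?r V n b) + ((cmod (?r V n a))\<^sup>2 * Re (?r (V - {a}) n b)
        + (cmod (?r V n c))\<^sup>2 * Re (?r (V - {c}) n b)) / t"
      unfolding Diff_Int_lessThan[symmetric] using assms
      by (intro exI[of _ "Suc (max a (max b c))"] allI impI scaled_ratio_three_le Im_approach) auto
  qed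
  have "cmod (of_real (p V b) * of_real (p V a) * of_real (p (V - {a}) c)
      - of_real (p V b) * of_real (p (V - {b}) a) * of_real (p (V - {a} - {b}) c))
    \<le> t * Re (of_real (p V b)) + ((cmod (of_real (p V a)))\<^sup>2 * Re (of_real (p (V - {a}) b))
        + (cmod (of_real (p V c)))\<^sup>2 * Re (of_real (p (V - {c}) b))) / t"
  proof (rule LIMSEQ_le[OF _ _ exI[of _ 0]])
    let ?z = "approach \<theta>"
    show "(\<lambda>k. cmod (g (?z k) V b * g (?z k) V a * g (?z k) (V - {a}) c - g (?z k) V b * g (?z k) (V - {b}) a * g (?z k) (V - {a} - {b}) c))
       \<longlonglongrightarrow> cmod (of_real (p V b) * of_real (p V a) * of_real (p (V - {a}) c)
          - of_real (p V b) * of_real (p (V - {b}) a) * of_real (p (V - {a} - {b}) c))"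
      using assms by (intro tendsto_intros green_lim) auto
    show "(\<lambda>k. t * Re (g (?z k) V b) + ((cmod (g (?z k) V a))\<^sup>2 * Re (g (?z k) (V - {a}) b)
        + (cmod (g (?z k) V c))\<^sup>2 * Re (g (?z k) (V - {c}) b)) / t)
       \<longlonglongrightarrow> t * Re (of_real (p V b)) + ((cmod (of_real (p V a)))\<^sup>2 * Re (of_real (p (V - {a}) b))
        + (cmod (of_real (p V c)))\<^sup>2 * Re (of_real (p (V - {c}) b))) / t"
      using assms by (intro tendsto_intros green_lim) auto
  qed (use 1 in auto)
  then show ?thesis by (simp flip: of_real_mult of_real_diff)
qed

text \<open>Taking \<open>t\<close> to \<open>0\<close> in \<open>atom_three_le\<close> shows that "\<open>x\<close> is inessential once \<open>y\<close> is deleted" is a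
  transitive relation on essential vertices, as in Gallai's lemma.\<close>

lemma atom_trans:
  assumes "a \<in> V" "b \<in> V" "c \<in> V" "a \<noteq> c" "a \<noteq> b" "b \<noteq> c"
    and pos: "p V a > 0" "p V b > 0"
    and 0: "p (V - {a}) b = 0" "p (V - {c}) b = 0"
  shows "p (V - {a}) c = 0"
proof -
  \<comment> \<open>Symmetry removes the second product on the left of \<open>atom_three_le\<close>;
    by the two vanishing hypotheses only \<open>t * p V b\<close> remains on the right.\<close>
  have "p (V - {b}) a = 0" using atom_sym[of a b] assms by auto
  then have *: "p V b * p V a * p (V - {a}) c \<le> t * p V b" if "t > 0" for t
    using atom_three_le[OF assms(1-6) that] 0 by simp
  have "p V a * p (V - {a}) c \<le> 0"
  proof (rule field_le_epsilon)
    fix t :: real assume "t > 0"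
    then have "p V b * (p V a * p (V - {a}) c) \<le> p V b * t" using *[of t] by (simp add: mult_ac)
    then show "p V a * p (V - {a}) c \<le> 0 + t" using pos by simp
  qed
  then show ?thesis using pos atom_nonneg[of \<theta> "V - {a}" c] by (auto simp: mult_le_0_iff)
qed

text \<open>Induction along a walk from \<open>a\<close>. In its last step from \<open>y\<close> to
  \<open>x\<close>, deleting \<open>x\<close> makes \<open>y\<close> inessential by adjacency,
  deleting \<open>a\<close> does so by induction, and \<open>atom_trans\<close> with middle vertex
  \<open>y\<close> carries this to \<open>x\<close>. A step from \<open>a\<close> itself is the
  adjacent case.\<close>

lemma critical_deletion:
  assumes conn: "(induced E V)\<^sup>*\<^sup>* a x" and aV: "a \<in> V" and pos: "\<And>v. v \<in> V \<Longrightarrow> p V v > 0"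
    and "x \<noteq> a"
  shows "p (V - {a}) x = 0"
  using conn \<open>x \<noteq> a\<close>
proof (induction rule: rtranclp_induct)
  case (step y x)
  then have yx: "y \<in> V" "x \<in> V" "E y x" "E x y" using sympD[OF sym] by (auto simp: induced_def)
  show ?case
  proof (cases "y = a")
    case True
    then show ?thesis using atom_adjacent[of a x] yx aV pos step.prems by auto
  next
    case False
    show ?thesis
    proof (cases "y = x")
      case True
      then show ?thesis using step.IH False by simp
    next
      case neq: False
      have "p (V - {x}) y = 0" using atom_adjacent[of x y] yx pos neq by auto
      then show ?thesis using atom_trans[of a y x] yx aV pos False neq step by auto
    qed
  qed
qed simp

text \<open>For \<open>u\<close> in \<open>F\<close> the atoms \<open>p (V - {u}) v\<close> vanish,
  so \<open>sum_atom_le\<close> becomes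
  \<open>p V u * (\<Sum>v\<in>F. p V v) \<le> p V u\<close>.\<close>

lemma critical_sum_atom_le_1:
  assumes conn: "\<And>x y. x \<in> V \<Longrightarrow> y \<in> V \<Longrightarrow> (induced E V)\<^sup>*\<^sup>* x y" and pos: "\<And>v. v \<in> V \<Longrightarrow> p V v > 0"
    and F: "finite F" "F \<subseteq> V"
  shows "(\<Sum>v\<in>F. p V v) \<le> 1"
proof (cases "F = {}")
  case False
  then obtain u where u: "u \<in> F" by blast
  have "(p V u)\<^sup>2 + (\<Sum>v\<in>F - {u}. p V u * \<bar>p V v - p (V - {u}) v\<bar>) \<le> p V u"
    using u F by (intro sum_atom_le) auto
  also have "(\<Sum>v\<in>F - {u}. p V u * \<bar>p V v - p (V - {u}) v\<bar>) = (\<Sum>v\<in>F - {u}. p V u * p V v)"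
  proof (rule sum.cong[OF refl])
    fix v assume v: "v \<in> F - {u}"
    then have "p (V - {u}) v = 0" using u F by (intro critical_deletion conn pos) auto
    then show "p V u * \<bar>p V v - p (V - {u}) v\<bar> = p V u * p V v" using atom_nonneg[of \<theta> V v] by simp
  qed
  finally have "p V u * (\<Sum>v\<in>F. p V v) \<le> p V u * 1"
    using u F by (simp add: sum.remove[of F u] distrib_left sum_distrib_left power2_eq_square)
  then show ?thesis using pos[of u] u F by (auto simp: mult_le_cancel_left_pos)
qed simp

end
end

section \<open>Mass transport\<close>

text \<open>Polynomials that on a neighbourhood of radius \<open>K\<close> around \<open>\<theta>\<close> converge to the indicator of \<open>{\<theta>}\<close>. They express
  an atom as a limit of linear combinations of closed walk counts, which makes it measurable in the graph.\<close>

definition bump_poly :: "real \<Rightarrow> real \<Rightarrow> nat \<Rightarrow> real poly" where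
  "bump_poly \<theta> K k = [:1 - (\<theta> / K)\<^sup>2, 2 * \<theta> / K\<^sup>2, - 1 / K\<^sup>2:] ^ k"

lemma poly_bump: "poly (bump_poly \<theta> K k) x = (1 - ((x - \<theta>) / K)\<^sup>2) ^ k"
proof -
  have "poly [:1 - (\<theta> / K)\<^sup>2, 2 * \<theta> / K\<^sup>2, - 1 / K\<^sup>2:] x = 1 - ((x - \<theta>) / K)\<^sup>2"
    by (cases "K = 0") (simp_all add: power_divide power2_eq_square field_simps)
  then show ?thesis unfolding bump_poly_def poly_power by (rule arg_cong)
qed

definition approx_atom :: "real \<Rightarrow> real \<Rightarrow> nat \<Rightarrow> (nat \<Rightarrow> nat \<Rightarrow> bool) \<Rightarrow> nat \<Rightarrow> real" where
  "approx_atom \<theta> K k E v =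
     (\<Sum>j\<le>degree (bump_poly \<theta> K k). coeff (bump_poly \<theta> K k) j * real (card (closed_walks E v j)))"

text \<open>\<open>K\<close> exceeds the distance from \<open>\<theta>\<close> to the support, so
  there the base \<open>1 - ((x - \<theta>) / K)\<^sup>2\<close> is positive and at most
  \<open>1\<close>, with equality only at \<open>\<theta>\<close>. Dominated convergence applies to
  its powers.\<close>

lemma approx_atom_tendsto:
  assumes mom: "has_moments (\<lambda>k. real (card (closed_walks E v k))) \<mu>"
    and supp: "AE x in \<mu>. \<bar>x\<bar> \<le> C" and K: "C + \<bar>\<theta>\<bar> < K" "0 < K"
  shows "(\<lambda>k. approx_atom \<theta> K k E v) \<longlonglongrightarrow> measure \<mu> {\<theta>}"
proof -
  interpret real_distribution \<mu> by (rule has_moments_real_distribution[OF mom])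
  have int: "integrable \<mu> (\<lambda>x. x ^ k)" "(\<integral>x. x ^ k \<partial>\<mu>) = real (card (closed_walks E v k))" for k
    using mom by (auto simp: has_moments_def)
  have eq: "approx_atom \<theta> K k E v = (\<integral>x. poly (bump_poly \<theta> K k) x \<partial>\<mu>)" for k
    unfolding approx_atom_def poly_altdef using int by (subst Bochner_Integration.integral_sum) auto
  have small: "\<bar>(x - \<theta>) / K\<bar> < 1" if "\<bar>x\<bar> \<le> C" for x
    using that K by (simp add: abs_divide)
  have sq: "((x - \<theta>) / K)\<^sup>2 < 1" if "\<bar>x\<bar> \<le> C" for x
    using small[OF that] by (simp add: abs_square_less_1)
  have "(\<lambda>k. \<integral>x. poly (bump_poly \<theta> K k) x \<partial>\<mu>) \<longlonglongrightarrow> (\<integral>x. indicator {\<theta>} x \<partial>\<mu>)"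
  proof (rule integral_dominated_convergence[where w = "\<lambda>_. 1"])
    show "(\<lambda>x. poly (bump_poly \<theta> K k) x) \<in> borel_measurable \<mu>" for k
      unfolding poly_bump by measurable
    show "AE x in \<mu>. (\<lambda>k. poly (bump_poly \<theta> K k) x) \<longlonglongrightarrow> indicator {\<theta>} x"
      using supp
    proof eventually_elim
      case (elim x)
      show ?case
      proof (cases "x = \<theta>")
        case False
        then have "0 < ((x - \<theta>) / K)\<^sup>2" using K by simp
        then have "\<bar>1 - ((x - \<theta>) / K)\<^sup>2\<bar> < 1" using sq[OF elim] by auto
        then have "(\<lambda>k. (1 - ((x - \<theta>) / K)\<^sup>2) ^ k) \<longlonglongrightarrow> 0" by (intro LIMSEQ_power_zero) simp
        then show ?thesis unfolding poly_bump using False by simp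
      qed (simp add: poly_bump)
    qed
    show "AE x in \<mu>. norm (poly (bump_poly \<theta> K k) x) \<le> 1" for k
      using supp
    proof eventually_elim
      case (elim x)
      have "\<bar>1 - ((x - \<theta>) / K)\<^sup>2\<bar> \<le> 1" using sq[OF elim] by (auto simp: abs_le_iff)
      then show ?case unfolding poly_bump by (simp add: power_abs power_le_one)
    qed
  qed auto
  then show ?thesis by (simp add: eq)
qed

text \<open>A transport function must be measurable and invariant on all graphs, which is hard to
  see for the description \<open>matching_measure\<close>. A \<open>liminf\<close> of combinations
  of walk counts has both properties and is the atom when the graph is simple with bounded degree
  and \<open>K\<close> is large.\<close>

definition atom_density :: "real \<Rightarrow> real \<Rightarrow> (nat \<Rightarrow> nat \<Rightarrow> bool) \<Rightarrow> nat \<Rightarrow> ennreal" where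
  "atom_density \<theta> K E v = liminf (\<lambda>k. ennreal (approx_atom \<theta> K k E v))"

section \<open>Invariance under isomorphism of components\<close>

lemma component_step: "x \<in> component E r \<Longrightarrow> E x y \<Longrightarrow> y \<in> component E r"
  by (auto simp: component_def intro: rtranclp.rtrancl_into_rtrancl)

lemma is_path_component:
  assumes "is_path E v p" "v \<in> component E r"
  shows "set p \<subseteq> component E r"
  using assms
proof (induction p rule: rev_induct)
  case (snoc w p)
  show ?case
  proof (cases "p = []")
    case True
    then show ?thesis using snoc.prems by (simp add: is_path_singleton)
  next
    case False
    then have "is_path E v p" "E (last p) w" using snoc.prems by (auto simp: is_path_snoc)
    then show ?thesis using snoc.IH snoc.prems(2) component_step[of "last p" E r w] last_in_set[OF False] by auto
  qed
qed simp

lemma closed_walks_component: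
  assumes "ws \<in> closed_walks E v k" "v \<in> component E r" "p \<in> set ws"
  shows "set p \<subseteq> component E r"
proof -
  obtain i where "i \<le> k" "p = ws ! i" using assms(1,3) by (auto simp: closed_walks_def in_set_conv_nth less_Suc_eq_le)
  then have "is_path E v p" using assms(1) by (simp add: closed_walks_def)
  then show ?thesis using assms(2) by (rule is_path_component)
qed

lemma is_path_map:
  assumes inj: "inj_on h C" and edges: "\<And>x y. x \<in> C \<Longrightarrow> y \<in> C \<Longrightarrow> E x y \<longleftrightarrow> E' (h x) (h y)"
    and p: "set p \<subseteq> C" and v: "v \<in> C"
  shows "is_path E' (h v) (map h p) \<longleftrightarrow> is_path E v p"
proof (cases "p = []")
  case True
  then show ?thesis by (simp add: is_path_def)
next
  case False
  have "hd p \<in> C" using p False by auto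
  then have "h (hd p) = h v \<longleftrightarrow> hd p = v" using inj v by (meson inj_onD)
  moreover have "distinct (map h p) \<longleftrightarrow> distinct p"
    using inj p by (simp add: distinct_map inj_on_subset)
  moreover have "E' (h (p ! i)) (h (p ! Suc i)) \<longleftrightarrow> E (p ! i) (p ! Suc i)" if "Suc i < length p" for i
  proof -
    have "p ! i \<in> C" "p ! Suc i \<in> C" using p that nth_mem[of i p] nth_mem[of "Suc i" p] by auto
    then show ?thesis using edges by blast
  qed
  ultimately show ?thesis using False by (auto simp: is_path_def hd_map)
qed

lemma tree_adj_map:
  assumes inj: "inj_on h C" and pq: "set p \<subseteq> C" "set q \<subseteq> C"
  shows "tree_adj (map h p) (map h q) \<longleftrightarrow> tree_adj p q"
proof -
  have half: "(\<exists>w. map h q = map h p @ [w]) \<longleftrightarrow> (\<exists>w. q = p @ [w])" if pq: "set p \<subseteq> C" "set q \<subseteq> C" for p q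
  proof
    assume "\<exists>w. map h q = map h p @ [w]"
    then obtain q' x where q: "q = q' @ [x]" "map h q' = map h p"
      by (cases q rule: rev_exhaust) auto
    have "inj_on h (set q' \<union> set p)" using pq q by (intro inj_on_subset[OF inj]) auto
    then have "q' = p" using q(2) by (simp add: inj_on_map_eq_map)
    then show "\<exists>w. q = p @ [w]" using q by blast
  qed auto
  show ?thesis unfolding tree_adj_def using half[OF pq] half[OF pq(2,1)] by simp
qed

text \<open>The paths in a closed walk never leave the component, where \<open>h\<close> is
  injective and respects edges both ways. So applying \<open>h\<close> to every vertex is a
  bijection of closed walks.\<close>

lemma card_closed_walks_iso:
  assumes v: "v \<in> component E r" and bij: "bij_betw h (component E r) (component E' r')"
    and edges: "\<And>x y. x \<in> component E r \<Longrightarrow> y \<in> component E r \<Longrightarrow> E x y \<longleftrightarrow> E' (h x) (h y)"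
  shows "card (closed_walks E' (h v) k) = card (closed_walks E v k)"
proof -
  let ?C = "component E r" and ?C' = "component E' r'"
  have inj: "inj_on h ?C" and img: "h ` ?C = ?C'" using bij by (auto simp: bij_betw_def)
  have hv: "h v \<in> ?C'" using v img by blast
  have iff: "map (map h) ws \<in> closed_walks E' (h v) k \<longleftrightarrow> ws \<in> closed_walks E v k"
    if ws: "\<And>p. p \<in> set ws \<Longrightarrow> set p \<subseteq> ?C" for ws
  proof (cases "length ws = Suc k")
    case len: True
    have n: "set (ws ! i) \<subseteq> ?C" if "i \<le> k" for i using ws len that by simp
    have e: "map h p = [h v] \<longleftrightarrow> p = [v]" if "set p \<subseteq> ?C" for p
      using that inj v by (auto simp: map_eq_Cons_conv inj_on_def)
    have pth: "is_path E' (h v) (map h (ws ! i)) \<longleftrightarrow> is_path E v (ws ! i)" if "i \<le> k" for i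
      using is_path_map[where E = E and E' = E', OF inj edges n[OF that] v] by blast
    have adj: "tree_adj (map h (ws ! i)) (map h (ws ! Suc i)) \<longleftrightarrow> tree_adj (ws ! i) (ws ! Suc i)" if "i < k" for i
      using that by (intro tree_adj_map[OF inj] n) auto
    show ?thesis unfolding closed_walks_def mem_Collect_eq
      using len e[OF n[of 0]] e[OF n[of k]] pth adj by (auto simp: nth_map)
  next
    case False
    then show ?thesis by (auto simp: closed_walks_def)
  qed
  have "closed_walks E' (h v) k = map (map h) ` closed_walks E v k"
  proof (intro subset_antisym subsetI)
    fix ws' assume ws': "ws' \<in> closed_walks E' (h v) k"
    let ?g = "inv_into ?C h"
    have sub: "set p \<subseteq> ?C'" if "p \<in> set ws'" for p by (rule closed_walks_component[OF ws' hv that])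
    have "map (map h) (map (map ?g) ws') = ws'"
    proof (rule nth_equalityI)
      fix i assume "i < length (map (map h) (map (map ?g) ws'))"
      then have "ws' ! i \<in> set ws'" "i < length ws'" by auto
      then show "map (map h) (map (map ?g) ws') ! i = ws' ! i"
        using sub[of "ws' ! i"] img by (auto intro!: map_idI simp: f_inv_into_f subset_iff)
    qed simp
    moreover have "map (map ?g) ws' \<in> closed_walks E v k"
    proof (subst iff[symmetric])
      show "set p \<subseteq> ?C" if "p \<in> set (map (map ?g) ws')" for p
        using that sub unfolding img[symmetric] by (fastforce intro: inv_into_into)
      show "map (map h) (map (map ?g) ws') \<in> closed_walks E' (h v) k" using calculation ws' by simp
    qed
    ultimately show "ws' \<in> map (map h) ` closed_walks E v k" by (metis image_eqI)
  next
    fix ws' assume "ws' \<in> map (map h) ` closed_walks E v k"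
    then obtain ws where ws: "ws' = map (map h) ws" "ws \<in> closed_walks E v k" by blast
    then show "ws' \<in> closed_walks E' (h v) k"
      using iff[of ws] closed_walks_component[OF ws(2) v] by simp
  qed
  moreover have "inj_on (map (map h)) (closed_walks E v k)"
  proof (rule inj_onI)
    fix ws ws' assume w: "ws \<in> closed_walks E v k" "ws' \<in> closed_walks E v k" "map (map h) ws = map (map h) ws'"
    have "inj_on (map h) (set ws \<union> set ws')"
    proof (rule inj_onI)
      fix p q assume "p \<in> set ws \<union> set ws'" "q \<in> set ws \<union> set ws'" "map h p = map h q"
      moreover then have "inj_on h (set p \<union> set q)"
        using closed_walks_component[OF w(1) v] closed_walks_component[OF w(2) v]
        by (intro inj_on_subset[OF inj]) auto
      ultimately show "p = q" by (simp add: inj_on_map_eq_map)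
    qed
    then show "ws = ws'" using w(3) by (simp add: inj_on_map_eq_map)
  qed
  ultimately show ?thesis by (simp add: card_image)
qed

lemma birooted_invariant_atom_density: "birooted_invariant (\<lambda>E x y. atom_density \<theta> K E y)"
  unfolding birooted_invariant_def
proof (intro allI impI, elim conjE)
  fix E r v E' r' h
  assume "v \<in> component E r" "bij_betw h (component E r) (component E' r')"
    "\<forall>x\<in>component E r. \<forall>y\<in>component E r. E x y \<longleftrightarrow> E' (h x) (h y)"
  then have "card (closed_walks E' (h v) k) = card (closed_walks E v k)" for k
    by (intro card_closed_walks_iso) auto
  then show "atom_density \<theta> K E' (h v) = atom_density \<theta> K E v"
    by (simp add: atom_density_def approx_atom_def)
qed

section \<open>Measurability of walk counts and components\<close>

lemma space_graph_space [simp]: "space graph_space = UNIV"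
  by (simp add: graph_space_def space_PiM)

lemma measurable_edge [measurable]: "Measurable.pred graph_space (\<lambda>E. E x y)"
proof -
  have "(\<lambda>E. E x) \<in> graph_space \<rightarrow>\<^sub>M PiM UNIV (\<lambda>_. count_space UNIV)"
    unfolding graph_space_def by (rule measurable_component_singleton) simp
  then show ?thesis
    by (rule measurable_compose) (rule measurable_component_singleton, simp)
qed

lemma measurable_is_path [measurable]: "Measurable.pred graph_space (\<lambda>E. is_path E v p)"
  unfolding is_path_def by measurable

lemma measurable_closed_walks [measurable]: "Measurable.pred graph_space (\<lambda>E. ws \<in> closed_walks E v k)"
  unfolding closed_walks_def mem_Collect_eq by measurable

text \<open>Coding walks by natural numbers turns the cardinality into a countable series of
  measurable indicators.\<close>

lemma measurable_card_closed_walks [measurable]: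
  "(\<lambda>E. real (card (closed_walks E v k))) \<in> borel_measurable graph_space"
proof -
  let ?t = "to_nat :: nat list list \<Rightarrow> nat"
  \<comment> \<open>The second condition keeps only genuine codes, so each walk is counted
    once.\<close>
  let ?P = "\<lambda>E n. from_nat n \<in> closed_walks E v k \<and> ?t (from_nat n) = n"
  have "real (card (closed_walks E v k)) = enn2real (\<Sum>n. if ?P E n then 1 else 0)" for E
  proof -
    have "n \<in> ?t ` closed_walks E v k \<longleftrightarrow> ?P E n" for n
      using from_nat_to_nat[where 'a = "nat list list"] by (auto intro: rev_image_eqI)
    then have "(\<Sum>n. if ?P E n then 1 else 0 :: ennreal) = (\<Sum>n. indicator (?t ` closed_walks E v k) n)"
      by (simp add: indicator_def of_bool_def)
    also have "\<dots> = (\<integral>\<^sup>+n. indicator (?t ` closed_walks E v k) n \<partial>count_space UNIV)"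
      by (rule nn_integral_count_space_nat[symmetric])
    also have "\<dots> = emeasure (count_space UNIV) (?t ` closed_walks E v k)"
      by (rule nn_integral_indicator) simp
    \<comment> \<open>\<open>enn2real\<close> sends an infinite sum to \<open>0\<close>, as
      \<open>card\<close> does with an infinite set.\<close>
    finally have "enn2real (\<Sum>n. if ?P E n then 1 else 0) = real (card (?t ` closed_walks E v k))"
      by (cases "finite (?t ` closed_walks E v k)") (simp_all add: emeasure_count_space)
    also have "card (?t ` closed_walks E v k) = card (closed_walks E v k)"
      by (rule card_image) (rule inj_on_subset[OF inj_to_nat], simp)
    finally show ?thesis by simp
  qed
  moreover have "(\<lambda>E. enn2real (\<Sum>n. if ?P E n then 1 else 0)) \<in> borel_measurable graph_space" by measurable
  ultimately show ?thesis by (simp only:)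
qed

lemma measurable_atom_density [measurable]: "(\<lambda>E. atom_density \<theta> K E v) \<in> borel_measurable graph_space"
  unfolding atom_density_def approx_atom_def by measurable

lemma measurable_reachable [measurable]: "Measurable.pred graph_space (\<lambda>E. E\<^sup>*\<^sup>* x y)"
proof -
  have "Measurable.pred graph_space (\<lambda>E. (E ^^ n) x y)" for n
  proof (induction n arbitrary: y)
    case (Suc n)
    then have [measurable]: "Measurable.pred graph_space (\<lambda>E. (E ^^ n) x w)" for w .
    show ?case unfolding relpowp.simps relcompp.simps by (simp add: OO_def) measurable
  qed simp
  then show ?thesis unfolding rtranclp_power by measurable
qed

lemma measurable_component [measurable]: "Measurable.pred graph_space (\<lambda>E. y \<in> component E x)"
  unfolding component_def mem_Collect_eq by measurable

section \<open>Atoms on the component of the root\<close>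

lemma locally_bounded_component:
  assumes "max_deg_le E r D"
  shows "is_locally_bounded E (component E r) D"
  unfolding is_locally_bounded_def
proof (intro ballI conjI)
  fix v assume "v \<in> component E r"
  then have f: "finite {w. E v w}" "card {w. E v w} \<le> D" using assms by (auto simp: max_deg_le_def)
  have s: "{w \<in> component E r. E v w} \<subseteq> {w. E v w}" by auto
  show "finite {w \<in> component E r. E v w}" using s f(1) by (rule finite_subset)
  show "card {w \<in> component E r. E v w} \<le> D" using card_mono[OF f(1) s] f(2) by simp
qed

text \<open>Links \<open>matching_measure E v\<close>, taken for \<open>E\<close> on all of
  \<open>nat\<close>, to the atoms of the graph induced on the component.\<close>

lemma closed_walks_induced_component:
  assumes v: "v \<in> component E r"
  shows "closed_walks E v k = closed_walks (induced E (component E r)) v k"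
proof -
  have "is_path E v p \<longleftrightarrow> is_path (induced E (component E r)) v p" for p
  proof
    assume p: "is_path E v p"
    have "set p \<subseteq> component E r" by (rule is_path_component[OF p v])
    then have "p ! i \<in> component E r" if "i < length p" for i using that nth_mem by blast
    then show "is_path (induced E (component E r)) v p"
      using p unfolding is_path_def by (auto simp: induced_def[of _ _ "p ! _"])
  next
    assume "is_path (induced E (component E r)) v p"
    then show "is_path E v p" by (rule is_path_mono) (simp add: induced_def)
  qed
  then show ?thesis by (simp add: closed_walks_def)
qed

lemma component_connected:
  assumes symE: "symp E" and x: "x \<in> component E r" and y: "y \<in> component E r"
  shows "(induced E (component E r))\<^sup>*\<^sup>* x y"
proof -
  have "E\<^sup>*\<^sup>* x r" using sympD[OF symp_rtranclp[OF symE]] x by (simp add: component_def)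
  then have "E\<^sup>*\<^sup>* x y" using y by (simp add: component_def)
  then show ?thesis
  proof (induction rule: rtranclp_induct)
    case (step y z)
    then have "y \<in> component E r" using x by (auto simp: component_def)
    then have "induced E (component E r) y z" using step component_step[of y E r z] by (simp add: induced_def)
    then show ?case using step.IH by (rule rtranclp.rtrancl_into_rtrancl[rotated])
  qed simp
qed

lemma atom_density_eq:
  assumes simple: "simple_graph E" and deg: "max_deg_le E r D" and v: "v \<in> component E r"
    and K: "real (Suc D) + \<bar>\<theta>\<bar> < K"
  shows "atom_density \<theta> K E v = ennreal (atom E \<theta> (component E r) v)"
    and "matching_measure E v = matching_measure (induced E (component E r)) v"
proof -
  let ?C = "component E r"
  have symE: "symp E" using simple by (auto simp: simple_graph_def symp_def)
  have lb: "is_locally_bounded E ?C D" by (rule locally_bounded_component[OF deg])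
  have cw: "closed_walks E v k = closed_walks (induced E ?C) v k" for k
    by (rule closed_walks_induced_component[OF v])
  show mm: "matching_measure E v = matching_measure (induced E ?C) v"
    unfolding matching_measure_def cw ..
  have "(\<lambda>k. approx_atom \<theta> K k E v) \<longlonglongrightarrow> atom E \<theta> ?C v"
    unfolding atom_def
  proof (rule approx_atom_tendsto)
    show "has_moments (\<lambda>k. real (card (closed_walks E v k))) (matching_measure (induced E ?C) v)"
      unfolding cw by (rule matching_measure_props(1)[OF symE v lb])
    show "AE x in matching_measure (induced E ?C) v. \<bar>x\<bar> \<le> real (Suc D)"
      by (rule matching_measure_props(2)[OF symE v lb])
  qed (use K in auto)
  then have "(\<lambda>k. ennreal (approx_atom \<theta> K k E v)) \<longlonglongrightarrow> ennreal (atom E \<theta> ?C v)"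
    by (rule tendsto_ennrealI)
  then show "atom_density \<theta> K E v = ennreal (atom E \<theta> ?C v)"
    unfolding atom_density_def by (intro lim_imp_Liminf) auto
qed

lemma sum_atom_density_le_1:
  assumes simple: "simple_graph E" and deg: "max_deg_le E r D" and crit: "critical \<theta> E r"
    and K: "real (Suc D) + \<bar>\<theta>\<bar> < K"
  shows "(\<Sum>v. if v \<in> component E r then atom_density \<theta> K E v else 0) \<le> 1"
    and "atom_density \<theta> K E r > 0"
proof -
  let ?C = "component E r"
  have symE: "symp E" using simple by (auto simp: simple_graph_def symp_def)
  have lb: "is_locally_bounded E ?C D" by (rule locally_bounded_component[OF deg])
  have pos: "atom E \<theta> ?C v > 0" if "v \<in> ?C" for v
    using crit that atom_density_eq(2)[OF simple deg that K] by (auto simp: critical_def essential_def atom_def)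
  have eq: "atom_density \<theta> K E v = ennreal (atom E \<theta> ?C v)" if "v \<in> ?C" for v
    by (rule atom_density_eq(1)[OF simple deg that K])
  have "r \<in> ?C" by (simp add: component_def)
  then show "atom_density \<theta> K E r > 0" using pos eq by simp
  have "(\<Sum>i<n. if i \<in> ?C then atom_density \<theta> K E i else 0) \<le> 1" for n
  proof -
    have "(\<Sum>i<n. if i \<in> ?C then atom_density \<theta> K E i else 0) = (\<Sum>i\<in>{..<n} \<inter> ?C. atom_density \<theta> K E i)"
      by (simp add: sum.inter_restrict)
    also have "\<dots> = (\<Sum>i\<in>{..<n} \<inter> ?C. ennreal (atom E \<theta> ?C i))" by (intro sum.cong) (auto simp: eq)
    also have "\<dots> = ennreal (\<Sum>i\<in>{..<n} \<inter> ?C. atom E \<theta> ?C i)"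
      by (intro sum_ennreal) (simp add: atom_def)
    also have "\<dots> \<le> ennreal 1"
      by (intro ennreal_leI critical_sum_atom_le_1[OF symE lb component_connected[OF symE] pos]) auto
    finally show ?thesis by simp
  qed
  then show "(\<Sum>v. if v \<in> ?C then atom_density \<theta> K E v else 0) \<le> 1"
    unfolding suminf_eq_SUP by (intro SUP_least)
qed

lemma finite_if_suminf_const_finite:
  fixes c :: ennreal
  assumes "c > 0" and fin: "(\<Sum>v::nat. if v \<in> V then c else 0) \<noteq> \<infinity>"
  shows "finite V"
proof (rule ccontr)
  assume inf: "infinite V"
  let ?s = "\<Sum>v::nat. if v \<in> V then c else 0"
  have le: "of_nat n * c \<le> ?s" for n
  proof -
    obtain F where F: "finite F" "card F = n" "F \<subseteq> V" using infinite_arbitrarily_large[OF inf] by blast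
    have "of_nat n * c = (\<Sum>v\<in>F. if v \<in> V then c else 0)"
      using F by (simp add: subset_iff)
    also have "\<dots> \<le> ?s" by (rule sum_le_suminf) (use F in auto)
    finally show ?thesis .
  qed
  have "(SUP n. of_nat n * c) \<le> ?s" by (rule SUP_least) (rule le)
  moreover have "(SUP n. of_nat n * c) = (SUP n. of_nat n :: ennreal) * c"
    by (rule SUP_mult_right_ennreal[symmetric])
  ultimately have "top * c \<le> ?s" by (simp add: ennreal_SUP_of_nat_eq_top)
  then have "?s = top" using assms(1) by (auto simp: ennreal_top_mult top_unique split: if_splits)
  then show False using fin by simp
qed

theorem theorem1p10:
  fixes M :: "'a measure" and G :: "'a \<Rightarrow> nat \<Rightarrow> nat \<Rightarrow> bool" and rt :: "'a \<Rightarrow> nat"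
    and D :: nat and \<theta> :: real
  assumes "prob_space M"
    and "(\<lambda>\<omega>. (G \<omega>, rt \<omega>)) \<in> M \<rightarrow>\<^sub>M graph_space \<Otimes>\<^sub>M count_space UNIV"
    and "AE \<omega> in M. simple_graph (G \<omega>) \<and> max_deg_le (G \<omega>) (rt \<omega>) D"
    and "unimodular M G rt"
    and "AE \<omega> in M. critical \<theta> (G \<omega>) (rt \<omega>)"
  shows "AE \<omega> in M. finite (component (G \<omega>) (rt \<omega>))"
proof -
  interpret prob_space M by (rule assms(1))
  \<comment> \<open>\<open>Suc D\<close> bounds the supports of the matching measures; the summand
    \<open>1\<close> gives the strict inequality for \<open>approx_atom_tendsto\<close>.\<close>
  define K where "K = real (Suc D) + \<bar>\<theta>\<bar> + 1"
  have K: "real (Suc D) + \<bar>\<theta>\<bar> < K" by (simp add: K_def)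
  have G [measurable]: "G \<in> M \<rightarrow>\<^sub>M graph_space"
    using measurable_compose[OF assms(2) measurable_fst] by simp
  have rt [measurable]: "rt \<in> M \<rightarrow>\<^sub>M count_space UNIV"
    using measurable_compose[OF assms(2) measurable_snd] by simp
  \<comment> \<open>The vertex coordinate is countable, so measurability in the graph for each fixed
    vertex suffices.\<close>
  have "(\<lambda>p. atom_density \<theta> K (fst p) (snd (snd p)))
      \<in> borel_measurable (graph_space \<Otimes>\<^sub>M count_space UNIV \<Otimes>\<^sub>M (count_space UNIV :: nat measure))"
    by (rule measurable_compose_countable[where f = "\<lambda>y p. atom_density \<theta> K (fst p) y"]) measurable
  then have "(\<lambda>(E, x, y). atom_density \<theta> K E y)
      \<in> borel_measurable (graph_space \<Otimes>\<^sub>M count_space UNIV \<Otimes>\<^sub>M count_space UNIV)"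
    by (simp add: case_prod_beta')
  then have transport:
    "(\<integral>\<^sup>+ \<omega>. (\<Sum>v. if v \<in> component (G \<omega>) (rt \<omega>) then atom_density \<theta> K (G \<omega>) v else 0) \<partial>M) =
     (\<integral>\<^sup>+ \<omega>. (\<Sum>v. if v \<in> component (G \<omega>) (rt \<omega>) then atom_density \<theta> K (G \<omega>) (rt \<omega>) else 0) \<partial>M)"
    using assms(4)[unfolded unimodular_def, rule_format, of "\<lambda>E x y. atom_density \<theta> K E y"]
      birooted_invariant_atom_density by blast
  have good: "AE \<omega> in M. simple_graph (G \<omega>) \<and> max_deg_le (G \<omega>) (rt \<omega>) D \<and> critical \<theta> (G \<omega>) (rt \<omega>)"
    using assms(3,5) by eventually_elim blast
  have "(\<integral>\<^sup>+ \<omega>. (\<Sum>v. if v \<in> component (G \<omega>) (rt \<omega>) then atom_density \<theta> K (G \<omega>) v else 0) \<partial>M) \<le> (\<integral>\<^sup>+ \<omega>. 1 \<partial>M)"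
    using good sum_atom_density_le_1(1)[OF _ _ _ K] by (intro nn_integral_mono_AE) (elim eventually_mono, blast)
  also have "\<dots> = 1" by (simp add: emeasure_space_1)
  finally have fin: "(\<integral>\<^sup>+ \<omega>. (\<Sum>v. if v \<in> component (G \<omega>) (rt \<omega>) then atom_density \<theta> K (G \<omega>) (rt \<omega>) else 0) \<partial>M) \<noteq> \<infinity>"
    unfolding transport by (auto simp: top_unique)
  have [measurable]: "(\<lambda>\<omega>. atom_density \<theta> K (G \<omega>) (rt \<omega>)) \<in> borel_measurable M"
    by (rule measurable_compose_countable[where f = "\<lambda>y \<omega>. atom_density \<theta> K (G \<omega>) y"]) measurable
  have [measurable]: "Measurable.pred M (\<lambda>\<omega>. v \<in> component (G \<omega>) (rt \<omega>))" for v
    by (rule measurable_compose_countable[where f = "\<lambda>y \<omega>. v \<in> component (G \<omega>) y"]) measurable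
  have "AE \<omega> in M. (\<Sum>v. if v \<in> component (G \<omega>) (rt \<omega>) then atom_density \<theta> K (G \<omega>) (rt \<omega>) else 0) \<noteq> \<infinity>"
    by (rule nn_integral_PInf_AE[OF _ fin]) measurable
  then show ?thesis using good
  proof eventually_elim
    case (elim \<omega>)
    then show ?case
      using finite_if_suminf_const_finite sum_atom_density_le_1(2)[OF _ _ _ K] by blast
  qed
qed

end
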